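(* Let $f(z)=z^d+c$ with $d\ge 2$ and $c\in\mathbb{C}$. Assume that $c$ does not belong to the basin of an attracting cycle of $f$. Then $$\chi_-(f,c)=\liminf_{n\to\infty}\frac1n\log|Df^n(c)|\ge 0.$$
   Context: $Df^n$ denotes the complex derivative of the $n$-th iterate $f^n$. *)

theory Defs
  imports "HOL-Analysis.Analysis"
begin

definition attracting_cycle :: "(complex \<Rightarrow> complex) \<Rightarrow> complex \<Rightarrow> nat \<Rightarrow> bool" where
  "attracting_cycle f z0 p \<longleftrightarrow> p > 0 \<and> (f ^^ p) z0 = z0 \<and> cmod (deriv (f ^^ p) z0) < 1"

definition cycle_orbit :: "(complex \<Rightarrow> complex) \<Rightarrow> complex \<Rightarrow> nat \<Rightarrow> complex set" where
  "cycle_orbit f z0 p = {(f ^^ k) z0 | k. k < p}"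

definition in_attracting_basin :: "(complex \<Rightarrow> complex) \<Rightarrow> complex \<Rightarrow> bool" where
  "in_attracting_basin f z \<longleftrightarrow>
     (\<exists>z0 p. attracting_cycle f z0 p \<and>
        (\<lambda>n. infdist ((f ^^ n) z) (cycle_orbit f z0 p)) \<longlonglongrightarrow> 0)"

definition lyap_term :: "(complex \<Rightarrow> complex) \<Rightarrow> complex \<Rightarrow> nat \<Rightarrow> ereal" where
  "lyap_term f z n =
     (if deriv (f ^^ n) z = 0 then -\<infinity> else ereal (ln (cmod (deriv (f ^^ n) z)) / real n))"

definition chi_minus :: "(complex \<Rightarrow> complex) \<Rightarrow> complex \<Rightarrow> ereal" where
  "chi_minus f z = liminf (lyap_term f z)"

end

theory Submission
  imports Defs "HOL-Complex_Analysis.Complex_Analysis"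
begin

text \<open>
  A disc that some iterate maps into a smaller concentric disc contains an attracting cycle; hence no
  such disc meets the orbit of \<open>c\<close>. Let \<open>x\<close> satisfy \<open>|x - c| \<le> \<rho>^d\<close> and let \<open>s\<close> be such that
  \<open>|f^s(x)| = \<rho>\<close> is the closest approach of \<open>x, ..., f^s(x)\<close> to the critical point. Pull the disc
  of radius \<open>\<rho>/2\<close> about \<open>f^s(x)\<close> back along this orbit segment, keeping track of a univalent
  parametrisation of the successive preimages by the unit disc. Conformal radius is lost only at the
  steps where the preimage contains \<open>0\<close>. There it omits a point of the disc of radius \<open>2\<rho>\<close> about \<open>0\<close>
  (otherwise this disc would be trapped), while the orbit point is at distance at least \<open>\<rho>\<close> from \<open>0\<close>,
  so by a weak Koebe theorem the loss is at most a constant factor. Such steps correspond to returns of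
  the critical point to a small disc about itself and are therefore rare. The last preimage omits a
  point at distance of order \<open>\<rho>^d\<close> from \<open>x\<close>, so its conformal radius is at most of this order, and
  \<open>|Df^(s+1)(x)| \<ge> exp(-\<epsilon>(s+1))\<close> follows for small \<open>\<rho>\<close>. The orbit of \<open>c\<close> is cut at
  successive closest approaches into such blocks, followed by a segment that stays away from \<open>0\<close>. On the
  latter an exponentially small derivative would, by a Pliss-type argument and compactness, yield two
  nearby orbit points such that the disc about the first is contracted towards the second, which again
  gives a trapped disc. If the orbit of \<open>c\<close> is unbounded, the derivatives are eventually increasing.
\<close>

section \<open>Univalent functions on the unit disc\<close>

text \<open>A weak Koebe theorem. The function
  \<open>1 - (\<phi> u - \<phi> 0) / (w - \<phi> 0)\<close> has no zeros, so it has a square root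
  \<open>h\<close> with \<open>h 0 = -1\<close>. Where \<open>h\<close> equals 1,
  \<open>\<phi>\<close> takes the value \<open>\<phi> 0\<close>, which injectivity allows only at
  the origin. Hence \<open>h\<close> omits 0 and 1, Schottky's theorem bounds it, and the Schwarz
  lemma makes the resulting bound for \<open>\<phi>\<close> linear in \<open>u\<close>.\<close>

lemma univalent_omitting_growth:
  obtains M :: real where "M > 0"
    "\<And>\<phi> w u. \<lbrakk>\<phi> holomorphic_on ball 0 1; inj_on \<phi> (ball 0 1); w \<notin> \<phi> ` ball 0 1; norm u < 1/2\<rbrakk>
        \<Longrightarrow> norm (\<phi> u - \<phi> 0) \<le> M * norm (w - \<phi> 0) * norm u"
    "\<And>\<phi> w. \<lbrakk>\<phi> holomorphic_on ball 0 1; inj_on \<phi> (ball 0 1); w \<notin> \<phi> ` ball 0 1\<rbrakk>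
        \<Longrightarrow> norm (deriv \<phi> 0) \<le> M * norm (w - \<phi> 0)"
proof -
  define B where "B = exp (pi * exp (pi * (2 + 2 * 1 + 12 * (2/3) / (1 - 2/3))))"
  \<comment> \<open>Adding 2 rather than 1 makes the bound on \<open>\<phi>\<close> strict, as the
    Schwarz lemma requires.\<close>
  define K where "K = B\<^sup>2 + 2"
  have K: "K > 0" unfolding K_def by (simp add: add_nonneg_pos)
  have main: "(\<forall>u. norm u < 1/2 \<longrightarrow> norm (\<phi> u - \<phi> 0) \<le> 2 * K * norm (w - \<phi> 0) * norm u) \<and>
      norm (deriv \<phi> 0) \<le> 2 * K * norm (w - \<phi> 0)"
    if hol: "\<phi> holomorphic_on ball 0 1" and inj: "inj_on \<phi> (ball 0 1)" and w: "w \<notin> \<phi> ` ball 0 1"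
    for \<phi> :: "complex \<Rightarrow> complex" and w
  proof -
    define a where "a = w - \<phi> 0"
    have a: "a \<noteq> 0" using w by (auto simp: a_def)
    define \<psi> where "\<psi> u = 1 - (\<phi> u - \<phi> 0) / a" for u
    have \<psi>hol: "\<psi> holomorphic_on ball 0 1"
      unfolding \<psi>_def using hol by (intro holomorphic_intros) (use a in auto)
    have \<psi>nz: "\<psi> u \<noteq> 0" if "u \<in> ball 0 1" for u
    proof
      assume "\<psi> u = 0"
      then have "\<phi> u = w" using a by (simp add: \<psi>_def a_def field_simps)
      then show False using w that by blast
    qed
    obtain g where g: "g holomorphic_on ball 0 1" "\<And>u. u \<in> ball 0 1 \<Longrightarrow> \<psi> u = g u ^ 2"
      using contractible_imp_holomorphic_sqrt[OF \<psi>hol convex_imp_contractible[OF convex_ball] \<psi>nz] by blast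
    have g0: "g 0 ^ 2 = 1" using g(2)[of 0] by (simp add: \<psi>_def)
    \<comment> \<open>Since \<open>g 0\<close> is 1 or -1, this choice of sign gives
      \<open>h 0 = -1\<close>.\<close>
    define h where "h u = - g 0 * g u" for u
    have h0: "h 0 = -1" using g0 by (simp add: h_def power2_eq_square)
    have h2: "h u ^ 2 = \<psi> u" if "u \<in> ball 0 1" for u
      using g(2)[OF that] g0 by (simp add: h_def power_mult_distrib)
    have hhol: "h holomorphic_on ball 0 1" unfolding h_def by (intro holomorphic_intros g)
    have h_nz: "h u \<noteq> 0" if "u \<in> ball 0 1" for u using h2[OF that] \<psi>nz[OF that] by auto
    have h_n1: "h u \<noteq> 1" if u: "u \<in> ball 0 1" for u
    proof
      assume h1: "h u = 1"
      then have "\<psi> u = 1" using h2[OF u] by simp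
      then have "\<phi> u = \<phi> 0" using a by (simp add: \<psi>_def)
      then have "u = 0" using inj u by (auto simp: inj_on_def)
      then show False using h1 h0 by simp
    qed
    have hB: "norm (h u) \<le> B" if "norm u < 1/2" for u
    proof -
      \<comment> \<open>Shrinking by 3/4 gives holomorphy on the closed unit disc; the disc of
        radius 1/2 becomes the one of radius 2/3 that enters \<open>B\<close>.\<close>
      have "norm ((h \<circ> (\<lambda>z. 3/4 * z)) (4/3 * u)) \<le> B"
        unfolding B_def
      proof (rule Schottky[where f = "h \<circ> (\<lambda>z. 3/4 * z)" and z = "4/3 * u"])
        show "h \<circ> (\<lambda>z. 3/4 * z) holomorphic_on cball 0 1"
          by (rule holomorphic_on_compose_gen[OF _ hhol]) (auto intro!: holomorphic_intros simp: norm_mult)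
        show "\<not> ((h \<circ> (\<lambda>z. 3/4 * z)) z = 0 \<or> (h \<circ> (\<lambda>z. 3/4 * z)) z = 1)" if "z \<in> cball 0 1" for z
          using h_nz[of "3/4 * z"] h_n1[of "3/4 * z"] that by (auto simp: norm_mult)
        show "norm (4/3 * u) \<le> 2/3" using that by (simp add: norm_mult)
      qed (auto simp: h0)
      then show ?thesis by simp
    qed
    have \<phi>B: "norm (\<phi> u - \<phi> 0) < K * norm a" if "norm u < 1/2" for u
    proof -
      have u: "u \<in> ball 0 1" using that by simp
      have "\<phi> u - \<phi> 0 = a * (1 - h u ^ 2)" using h2[OF u] a by (simp add: \<psi>_def)
      then have "norm (\<phi> u - \<phi> 0) = norm a * norm (1 - h u ^ 2)" by (simp add: norm_mult)
      moreover have "norm (1 - h u ^ 2) \<le> 1 + norm (h u) ^ 2"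
        using norm_triangle_ineq4[of 1 "h u ^ 2"] by (simp add: norm_power)
      moreover have "norm (h u) ^ 2 \<le> B ^ 2" by (rule power_mono[OF hB[OF that]]) simp
      ultimately show ?thesis using a unfolding K_def
        by (smt (verit) mult.commute mult_le_cancel_left mult_less_cancel_left_pos norm_ge_zero zero_less_norm_iff)
    qed
    define F where "F v = (\<phi> (v/2) - \<phi> 0) / of_real (K * norm a)" for v
    have Ka: "K * norm a > 0" using K a by simp
    have Fhol: "F holomorphic_on ball 0 1"
    proof -
      have "(\<phi> \<circ> (\<lambda>v. v/2)) holomorphic_on ball 0 1"
        by (rule holomorphic_on_compose_gen[OF _ hol]) (auto intro!: holomorphic_intros)
      then show ?thesis unfolding F_def o_def using K a by (intro holomorphic_intros) auto
    qed
    have F0: "F 0 = 0" by (simp add: F_def)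
    have F1: "norm (F z) < 1" if "norm z < 1" for z
    proof -
      have "norm (F z) = norm (\<phi> (z/2) - \<phi> 0) / (K * norm a)"
        using Ka unfolding F_def norm_divide norm_of_real by simp
      then show ?thesis using \<phi>B[of "z/2"] that by (simp add: pos_divide_less_eq[OF Ka])
    qed
    have "norm (\<phi> u - \<phi> 0) \<le> 2 * K * norm (w - \<phi> 0) * norm u" if "norm u < 1/2" for u
    proof -
      have "norm (F (2*u)) \<le> norm (2*u)"
        by (rule Schwarz_Lemma(1)[OF Fhol F0 F1]) (use that in \<open>auto simp: norm_mult\<close>)
      moreover have "norm (F (2*u)) = norm (\<phi> u - \<phi> 0) / (K * norm a)"
        using Ka unfolding F_def norm_divide norm_of_real by simp
      ultimately show ?thesis by (simp add: pos_divide_le_eq[OF Ka] norm_mult mult_ac flip: a_def)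
    qed
    moreover have "norm (deriv \<phi> 0) \<le> 2 * K * norm (w - \<phi> 0)"
    proof -
      have d\<phi>: "(\<phi> has_field_derivative deriv \<phi> 0) (at (0/2))"
        using hol holomorphic_derivI[of \<phi> "ball 0 1" 0 UNIV] by simp
      have "((\<lambda>v. \<phi> (v/2)) has_field_derivative deriv \<phi> 0 * (1/2)) (at 0)"
        by (rule DERIV_chain2[where f=\<phi> and g="\<lambda>v. v/2", OF d\<phi>]) (auto intro!: derivative_eq_intros)
      then have "(F has_field_derivative deriv \<phi> 0 * (1/2) / of_real (K * norm a)) (at 0)"
        unfolding F_def using K a by (auto intro!: derivative_eq_intros)
      then have "deriv F 0 = deriv \<phi> 0 * (1/2) / of_real (K * norm a)" by (rule DERIV_imp_deriv)
      moreover have "norm (deriv F 0) \<le> 1"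
        by (rule Schwarz_Lemma(2)[OF Fhol F0 F1, where \<xi>=0]) auto
      ultimately have "norm (deriv \<phi> 0) / 2 / (K * norm a) \<le> 1"
        using Ka by (simp add: norm_divide norm_mult del: of_real_mult)
      then have "norm (deriv \<phi> 0) / 2 \<le> 1 * (K * norm a)" by (simp only: pos_divide_le_eq[OF Ka])
      then show ?thesis by (simp add: a_def)
    qed
    ultimately show ?thesis by blast
  qed
  show ?thesis
    by (rule that[of "2 * K"]) (use K main in auto)
qed

section \<open>Lifting univalent discs through \<open>z ^ d + c\<close>\<close>

lemma contractible_imp_holomorphic_root:
  assumes "f holomorphic_on S" "contractible S" "\<And>z. z \<in> S \<Longrightarrow> f z \<noteq> 0" "d > 0"
  obtains g where "g holomorphic_on S" "\<And>z. z \<in> S \<Longrightarrow> f z = g z ^ d"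
proof -
  obtain l where l: "l holomorphic_on S" "\<And>z. z \<in> S \<Longrightarrow> f z = exp (l z)"
    using contractible_imp_holomorphic_log[OF assms(1-3)] by blast
  show ?thesis
  proof (rule that[of "\<lambda>z. exp (l z / of_nat d)"])
    show "(\<lambda>z. exp (l z / of_nat d)) holomorphic_on S" using assms(4) by (intro holomorphic_intros l) auto
    show "f z = exp (l z / of_nat d) ^ d" if "z \<in> S" for z
      using l(2)[OF that] assms(4) by (simp add: exp_of_nat_mult[symmetric])
  qed
qed

text \<open>As \<open>\<phi>\<close> omits the critical value, \<open>\<phi> - c\<close> is
  zero-free on the disc and has a holomorphic \<open>d\<close>-th root, which inherits injectivity
  from \<open>\<phi>\<close>.\<close>

lemma lift_unramified:
  assumes "\<phi> holomorphic_on ball 0 1" "inj_on \<phi> (ball 0 1)" "c \<notin> \<phi> ` ball 0 1" "\<phi> 0 = z ^ d + c" "d > 0"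
  obtains \<eta> where "\<eta> holomorphic_on ball 0 1" "inj_on \<eta> (ball 0 1)" "\<eta> 0 = z"
    "\<And>u. u \<in> ball 0 1 \<Longrightarrow> \<eta> u ^ d + c = \<phi> u"
proof -
  obtain g where g: "g holomorphic_on ball 0 1" "\<And>u. u \<in> ball 0 1 \<Longrightarrow> \<phi> u - c = g u ^ d"
    by (rule contractible_imp_holomorphic_root[of "\<lambda>u. \<phi> u - c" "ball 0 1" d])
       (use assms in \<open>auto intro!: holomorphic_intros convex_imp_contractible\<close>)
  \<comment> \<open>The factor \<open>z / g 0\<close> is a \<open>d\<close>-th root of unity and
    selects the branch through \<open>z\<close>.\<close>
  define \<eta> where "\<eta> u = z / g 0 * g u" for u
  have g0: "g 0 ^ d = z ^ d" using g(2)[of 0] assms(4) by simp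
  have "z ^ d \<noteq> 0" using assms(3,4) by force
  then have z: "z \<noteq> 0" and g0nz: "g 0 \<noteq> 0" using g0 assms(5) by (auto simp: power_0_left)
  have eq: "\<eta> u ^ d + c = \<phi> u" if "u \<in> ball 0 1" for u
    using g(2)[OF that] g0 z g0nz by (simp add: \<eta>_def power_mult_distrib power_divide algebra_simps)
  show ?thesis
  proof (rule that)
    show "\<eta> holomorphic_on ball 0 1" unfolding \<eta>_def using g0nz by (intro holomorphic_intros g) auto
    show "inj_on \<eta> (ball 0 1)" using eq assms(2) by (metis inj_on_def)
    show "\<eta> 0 = z" using g0nz by (simp add: \<eta>_def)
  qed (use eq in auto)
qed

lemma norm_power_less_1:
  fixes v :: complex
  assumes "norm v < 1" "d > 0"
  shows "norm (v ^ d) < 1"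
  using assms by (simp add: norm_power power_less_one_iff)

text \<open>Write \<open>\<phi> u - c = u * h u\<close>. Injectivity makes \<open>h\<close>
  zero-free, so \<open>h\<close> is a \<open>d\<close>-th power of some \<open>k\<close>, and
  \<open>v * k (v ^ d)\<close> is the lift. Its rotational symmetry later allows any of the
  \<open>d\<close> preimages to be reached.\<close>

lemma lift_ramified_centred:
  assumes hol: "\<phi> holomorphic_on ball 0 1" and inj: "inj_on \<phi> (ball 0 1)" and "\<phi> 0 = c" "d > 0"
  obtains \<psi> where "\<psi> holomorphic_on ball 0 1" "inj_on \<psi> (ball 0 1)" "\<psi> 0 = 0"
    "\<And>v. v \<in> ball 0 1 \<Longrightarrow> \<psi> v ^ d + c = \<phi> (v ^ d)"
    "\<And>v \<zeta>. v \<in> ball 0 1 \<Longrightarrow> \<zeta> ^ d = 1 \<Longrightarrow> \<psi> (\<zeta> * v) = \<zeta> * \<psi> v"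
proof -
  obtain h where h: "h holomorphic_on ball 0 1" "\<And>u. norm u < 1 \<Longrightarrow> \<phi> u - c = u * h u"
      "deriv (\<lambda>u. \<phi> u - c) 0 = h 0"
    by (rule Schwarz3[of "\<lambda>u. \<phi> u - c" 1]) (use assms in \<open>auto intro!: holomorphic_intros\<close>)
  have "deriv (\<lambda>u. \<phi> u - c) 0 \<noteq> 0"
    by (rule holomorphic_injective_imp_regular[where S="ball 0 1"])
       (use hol inj in \<open>auto intro!: holomorphic_intros simp: inj_on_def\<close>)
  then have hnz: "h u \<noteq> 0" if "u \<in> ball 0 1" for u
    using h(2)[of u] h(3) that inj assms(3) by (cases "u = 0") (auto simp: inj_on_def)
  obtain k where k: "k holomorphic_on ball 0 1" "\<And>u. u \<in> ball 0 1 \<Longrightarrow> h u = k u ^ d"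
    by (rule contractible_imp_holomorphic_root[of h "ball 0 1" d])
       (use assms h hnz in \<open>auto intro!: convex_imp_contractible\<close>)
  define \<psi> where "\<psi> v = v * k (v ^ d)" for v
  have pw: "v ^ d \<in> ball 0 1" if "v \<in> ball 0 1" for v :: complex
    using norm_power_less_1[of v d] that assms(4) by simp
  have eq: "\<psi> v ^ d + c = \<phi> (v ^ d)" if "v \<in> ball 0 1" for v
    using k(2)[OF pw[OF that]] h(2)[of "v ^ d"] pw[OF that]
    by (simp add: \<psi>_def power_mult_distrib algebra_simps)
  show ?thesis
  proof (rule that)
    have "(k \<circ> (\<lambda>v. v ^ d)) holomorphic_on ball 0 1"
      by (rule holomorphic_on_compose_gen[OF _ k(1)]) (use pw in \<open>auto intro!: holomorphic_intros\<close>)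
    then show "\<psi> holomorphic_on ball 0 1" unfolding \<psi>_def o_def by (intro holomorphic_intros)
    show "inj_on \<psi> (ball 0 1)"
    proof (rule inj_onI)
      fix v v' assume v: "v \<in> ball 0 1" "v' \<in> ball 0 1" and "\<psi> v = \<psi> v'"
      then have "\<phi> (v ^ d) = \<phi> (v' ^ d)" using eq by metis
      then have e: "v ^ d = v' ^ d" using inj pw v by (auto simp: inj_on_def)
      have "k (v ^ d) \<noteq> 0" using hnz[OF pw[OF v(1)]] k(2)[OF pw[OF v(1)]] assms(4) by auto
      then show "v = v'" using \<open>\<psi> v = \<psi> v'\<close> e by (simp add: \<psi>_def)
    qed
    show "\<psi> 0 = 0" by (simp add: \<psi>_def)
    show "\<psi> (\<zeta> * v) = \<zeta> * \<psi> v" if "v \<in> ball 0 1" "\<zeta> ^ d = 1" for v \<zeta>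
      using that by (simp add: \<psi>_def power_mult_distrib)
  qed (use eq in auto)
qed

text \<open>The form in which the growth bound is applied. If a point \<open>w\<close> with
  \<open>norm w < 2 * \<rho>\<close> is omitted, then
  \<open>\<rho> \<le> norm (\<psi> v) \<le> 2 * M * \<rho> * norm v\<close> for
  \<open>norm v < 1/2\<close>, so \<open>v\<close> cannot be close to the centre.\<close>

lemma univalent_omitting_lower_bound:
  obtains M \<kappa> :: real where "M > 0" "0 < \<kappa>" "\<kappa> < 1"
    "\<And>\<phi> w. \<lbrakk>\<phi> holomorphic_on ball 0 1; inj_on \<phi> (ball 0 1); w \<notin> \<phi> ` ball 0 1\<rbrakk>
        \<Longrightarrow> norm (deriv \<phi> 0) \<le> M * norm (w - \<phi> 0)"
    "\<And>\<psi> v \<rho>. \<lbrakk>\<psi> holomorphic_on ball 0 1; inj_on \<psi> (ball 0 1); \<psi> 0 = 0; \<rho> > 0;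
        \<not> ball 0 (2 * \<rho>) \<subseteq> \<psi> ` ball 0 1; norm (\<psi> v) \<ge> \<rho>\<rbrakk> \<Longrightarrow> \<kappa> \<le> norm v"
proof -
  obtain M :: real where M: "M > 0"
    "\<And>\<phi> w u. \<lbrakk>\<phi> holomorphic_on ball 0 1; inj_on \<phi> (ball 0 1); w \<notin> \<phi> ` ball 0 1; norm u < 1/2\<rbrakk>
        \<Longrightarrow> norm (\<phi> u - \<phi> 0) \<le> M * norm (w - \<phi> 0) * norm u"
    "\<And>\<phi> w. \<lbrakk>\<phi> holomorphic_on ball 0 1; inj_on \<phi> (ball 0 1); w \<notin> \<phi> ` ball 0 1\<rbrakk>
        \<Longrightarrow> norm (deriv \<phi> 0) \<le> M * norm (w - \<phi> 0)"
    by (rule univalent_omitting_growth) (rule that; assumption)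
  define \<kappa> where "\<kappa> = min (1/2) (1 / (2 * M))"
  have "\<kappa> \<le> norm v" if "\<psi> holomorphic_on ball 0 1" "inj_on \<psi> (ball 0 1)" "\<psi> 0 = 0" "\<rho> > 0"
    "\<not> ball 0 (2 * \<rho>) \<subseteq> \<psi> ` ball 0 1" "norm (\<psi> v) \<ge> \<rho>" for \<psi> :: "complex \<Rightarrow> complex" and v \<rho>
  proof (rule ccontr)
    note prem = that(5)
    assume "\<not> \<kappa> \<le> norm v"
    then have v: "norm v < 1/2" "norm v < 1 / (2 * M)" by (auto simp: \<kappa>_def)
    obtain w where "w \<in> ball 0 (2 * \<rho>)" and w': "w \<notin> \<psi> ` ball 0 1" using prem by blast
    then have w: "norm w < 2 * \<rho>" by simp
    have "\<rho> \<le> M * norm w * norm v" using M(2)[OF that(1,2) w' v(1)] that by simp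
    also have "\<dots> \<le> M * (2 * \<rho>) * norm v" using w M(1) by (intro mult_right_mono mult_left_mono) auto
    also have "\<dots> = \<rho> * (2 * M * norm v)" by simp
    also have "\<dots> < \<rho> * 1"
      using v(2) M(1) that(4) by (intro mult_strict_left_mono) (auto simp: field_simps)
    finally show False by simp
  qed
  then show ?thesis using M by (intro that[of M \<kappa>]) (auto simp: \<kappa>_def)
qed

lemma deriv_Moebius_function:
  assumes "1 - cnj w * z \<noteq> 0"
  shows "(Moebius_function 0 w has_field_derivative (1 - of_real (norm w ^ 2)) / (1 - cnj w * z) ^ 2) (at z)"
proof -
  have "((\<lambda>z. (z - w) / (1 - cnj w * z)) has_field_derivative
      (1 * (1 - cnj w * z) - (z - w) * (- cnj w)) / ((1 - cnj w * z) * (1 - cnj w * z))) (at z)"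
    by (rule DERIV_divide) (use assms in \<open>auto intro!: derivative_eq_intros\<close>)
  moreover have "1 * (1 - cnj w * z) - (z - w) * (- cnj w) = 1 - of_real (norm w ^ 2)"
    using complex_norm_square[of w] by (simp add: algebra_simps)
  ultimately have "((\<lambda>z. (z - w) / (1 - cnj w * z)) has_field_derivative
      (1 - of_real (norm w ^ 2)) / ((1 - cnj w * z) * (1 - cnj w * z))) (at z)"
    by (simp only:)
  then show ?thesis
    by (simp add: Moebius_function_simple[abs_def] power2_eq_square)
qed

text \<open>Recentre \<open>\<phi>\<close> at the preimage of \<open>c\<close>, so that \<open>\<phi>(u^d) - c\<close> has a \<open>d\<close>-th root \<open>\<psi>\<close>; recentring
  \<open>\<psi>\<close> at the preimage \<open>v\<close> of \<open>z\<close> gives \<open>\<eta>\<close>. The factor \<open>|v|^(d-1)\<close> bounds the hyperbolic derivative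
  of \<open>u \<mapsto> u^d\<close> at \<open>v\<close> from below.\<close>

lemma lift_ramified:
  assumes hol: "\<phi> holomorphic_on ball 0 1" and inj: "inj_on \<phi> (ball 0 1)" and c: "c \<in> \<phi> ` ball 0 1"
    and \<phi>0: "\<phi> 0 = z ^ d + c" and z: "z \<noteq> 0" and d: "d > 0"
  obtains \<eta> \<psi> v where "\<eta> holomorphic_on ball 0 1" "inj_on \<eta> (ball 0 1)" "\<eta> 0 = z"
    "\<And>u. u \<in> ball 0 1 \<Longrightarrow> \<eta> u ^ d + c \<in> \<phi> ` ball 0 1"
    "\<psi> holomorphic_on ball 0 1" "inj_on \<psi> (ball 0 1)" "\<psi> 0 = 0" "v \<in> ball 0 1" "\<psi> v = z"
    "\<And>u. u \<in> ball 0 1 \<Longrightarrow> \<psi> u ^ d + c \<in> \<phi> ` ball 0 1"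
    "norm (of_nat d * z ^ (d - 1)) * norm (deriv \<eta> 0) \<ge> norm v ^ (d - 1) * norm (deriv \<phi> 0)"
proof -
  obtain a where a: "a \<in> ball 0 1" "\<phi> a = c" using c by blast
  define B where "B = Moebius_function 0 (-a)"
  have Bhol: "B holomorphic_on ball 0 1"
    unfolding B_def using a by (intro Moebius_function_holomorphic) auto
  have BD: "B u \<in> ball 0 1" if "u \<in> ball 0 1" for u
    unfolding B_def using that a Moebius_function_norm_lt_1 by auto
  have Binj: "inj_on B (ball 0 1)"
  proof (rule inj_on_inverseI)
    show "Moebius_function 0 a (B u) = u" if "u \<in> ball 0 1" for u
      unfolding B_def using that a Moebius_function_compose by auto
  qed
  have B0: "B 0 = a" "B (-a) = 0"
    by (simp_all add: B_def Moebius_function_eq_zero Moebius_function_of_zero)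
  have \<phi>Bhol: "(\<phi> \<circ> B) holomorphic_on ball 0 1"
    by (rule holomorphic_on_compose_gen[OF Bhol hol]) (use BD in blast)
  have \<phi>Binj: "inj_on (\<phi> \<circ> B) (ball 0 1)"
    by (rule comp_inj_on[OF Binj]) (rule inj_on_subset[OF inj], use BD in blast)
  have \<phi>B0: "(\<phi> \<circ> B) 0 = c" using a B0 by simp
  obtain \<psi> where \<psi>: "\<psi> holomorphic_on ball 0 1" "inj_on \<psi> (ball 0 1)" "\<psi> 0 = 0"
    "\<And>v. v \<in> ball 0 1 \<Longrightarrow> \<psi> v ^ d + c = (\<phi> \<circ> B) (v ^ d)"
    "\<And>v \<zeta>. v \<in> ball 0 1 \<Longrightarrow> \<zeta> ^ d = 1 \<Longrightarrow> \<psi> (\<zeta> * v) = \<zeta> * \<psi> v"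
    by (rule lift_ramified_centred[OF \<phi>Bhol \<phi>Binj \<phi>B0 d]) (rule that; assumption)
  \<comment> \<open>Because \<open>B\<close> sends \<open>-a\<close> to 0, \<open>\<psi> v1\<close>
    satisfies the same equation as \<open>z\<close>, namely that its \<open>d\<close>-th power is
    \<open>z ^ d\<close>. Multiplying \<open>v1\<close> by the root of unity \<open>\<zeta>\<close>
    then gives a preimage of \<open>z\<close> itself.\<close>
  obtain v1 where "- a = v1 ^ d"
    by (rule exists_complex_root[of d "-a"]) (use d in simp)
  then have v1: "v1 ^ d = - a" by (rule sym)
  have pw1: "norm v < 1" if "v ^ d = -a" for v
  proof (rule ccontr)
    assume "\<not> norm v < 1"
    then have "norm (v ^ d) \<ge> 1" by (simp add: norm_power one_le_power)
    then show False using that a by simp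
  qed
  have e1: "\<psi> v1 ^ d = z ^ d"
    using \<psi>(4)[of v1] pw1[OF v1] v1 \<phi>0 B0 by simp
  then have nz: "\<psi> v1 \<noteq> 0" using z d by (auto simp: power_0_left)
  define \<zeta> where "\<zeta> = z / \<psi> v1"
  have \<zeta>: "\<zeta> ^ d = 1" using e1 nz by (simp add: \<zeta>_def power_divide z)
  define v where "v = \<zeta> * v1"
  have vd: "v ^ d = - a" using \<zeta> v1 by (simp add: v_def power_mult_distrib)
  have v: "norm v < 1" using pw1[OF vd] .
  have \<psi>v: "\<psi> v = z" using \<psi>(5)[of v1 \<zeta>] pw1[OF v1] \<zeta> nz by (simp add: v_def \<zeta>_def)
  define C where "C = Moebius_function 0 (-v)"
  have Chol: "C holomorphic_on ball 0 1"
    unfolding C_def using v by (intro Moebius_function_holomorphic) auto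
  have CD: "C u \<in> ball 0 1" if "u \<in> ball 0 1" for u
    unfolding C_def using that v Moebius_function_norm_lt_1 by auto
  have Cinj: "inj_on C (ball 0 1)"
  proof (rule inj_on_inverseI)
    show "Moebius_function 0 v (C u) = u" if "u \<in> ball 0 1" for u
      unfolding C_def using that v Moebius_function_compose by auto
  qed
  have C0: "C 0 = v" by (simp add: C_def Moebius_function_of_zero)
  define \<eta> where "\<eta> = \<psi> \<circ> C"
  have \<psi>im: "\<psi> u ^ d + c \<in> \<phi> ` ball 0 1" if "u \<in> ball 0 1" for u
    using \<psi>(4)[OF that] BD[of "u ^ d"] norm_power_less_1[of u d] d that by auto
  have Cd: "(C has_field_derivative (1 - of_real (norm v ^ 2))) (at 0)"
    using deriv_Moebius_function[of "-v" 0] by (simp add: C_def)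
  have \<psi>d: "(\<psi> has_field_derivative deriv \<psi> v) (at v)"
    by (rule holomorphic_derivI[OF \<psi>(1)]) (use v in auto)
  have "(\<eta> has_field_derivative deriv \<psi> v * (1 - of_real (norm v ^ 2))) (at 0)"
    unfolding \<eta>_def o_def by (rule DERIV_chain2[OF _ Cd]) (use \<psi>d C0 in simp)
  then have \<eta>d: "deriv \<eta> 0 = deriv \<psi> v * (1 - of_real (norm v ^ 2))" by (rule DERIV_imp_deriv)
  have na: "norm a = norm v ^ d" using vd norm_power[of v d] by simp
  have a1: "norm a < 1" using a by simp
  have n_sub: "norm (1 - complex_of_real r) = 1 - r" if "r < 1" for r
    using norm_of_real[of "1 - r", where 'a=complex] that by simp
  have a2: "norm a ^ 2 < 1" using a1 by (simp add: abs_square_less_1)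
  have q1: "(1 - complex_of_real (norm a ^ 2)) \<noteq> 0"
    using n_sub[OF a2] a2 by (intro notI) simp
  have "1 - cnj (-a) * (-a) = 1 - of_real (norm a ^ 2)"
    using complex_norm_square[of a] by (simp add: mult.commute)
  then have Bd: "(B has_field_derivative 1 / (1 - of_real (norm a ^ 2))) (at (-a))"
    using deriv_Moebius_function[of "-a" "-a"] q1 by (simp add: B_def power2_eq_square)
  have \<phi>d: "(\<phi> has_field_derivative deriv \<phi> 0) (at (B (-a)))"
    using holomorphic_derivI[OF hol] B0 by simp
  have \<phi>B: "((\<lambda>w. \<phi> (B w)) has_field_derivative deriv \<phi> 0 * (1 / (1 - of_real (norm a ^ 2)))) (at (-a))"
    by (rule DERIV_chain2[OF \<phi>d Bd])
  have pd: "((\<lambda>u. u ^ d) has_field_derivative of_nat d * v ^ (d - 1)) (at v)"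
    by (auto intro!: derivative_eq_intros)
  \<comment> \<open>The identity \<open>\<psi> u ^ d + c = \<phi> (B (u ^ d))\<close> is
    differentiated at \<open>v\<close> on both sides; uniqueness of the derivative relates
    \<open>deriv \<psi> v\<close> to \<open>deriv \<phi> 0\<close>.\<close>
  have "((\<lambda>u. \<phi> (B (u ^ d))) has_field_derivative
      deriv \<phi> 0 * (1 / (1 - of_real (norm a ^ 2))) * (of_nat d * v ^ (d - 1))) (at v)"
    by (rule DERIV_chain2[OF _ pd, where f="\<lambda>w. \<phi> (B w)"]) (use \<phi>B vd in simp)
  moreover have "((\<lambda>u. \<phi> (B (u ^ d))) has_field_derivative of_nat d * z ^ (d - 1) * deriv \<psi> v) (at v)"
  proof (rule has_field_derivative_transform_within_open)
    show "((\<lambda>u. \<psi> u ^ d + c) has_field_derivative of_nat d * z ^ (d - 1) * deriv \<psi> v) (at v)"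
      by (auto intro!: derivative_eq_intros \<psi>d simp: \<psi>v)
    show "\<psi> u ^ d + c = \<phi> (B (u ^ d))" if "u \<in> ball 0 1" for u using \<psi>(4)[OF that] by simp
  qed (use v in auto)
  ultimately have "of_nat d * z ^ (d - 1) * deriv \<psi> v =
      deriv \<phi> 0 * (1 / (1 - of_real (norm a ^ 2))) * (of_nat d * v ^ (d - 1))"
    using DERIV_unique by blast
  then have "norm (of_nat d * z ^ (d - 1)) * norm (deriv \<psi> v) =
      norm (deriv \<phi> 0 * (1 / (1 - of_real (norm a ^ 2))) * (of_nat d * v ^ (d - 1)))"
    by (simp only: norm_mult[symmetric])
  also have "\<dots> = norm (deriv \<phi> 0) / norm (1 - complex_of_real (norm a ^ 2)) * (of_nat d * norm v ^ (d - 1))"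
    by (simp add: norm_mult norm_divide norm_power del: of_real_power)
  also have "norm (1 - complex_of_real (norm a ^ 2)) = 1 - norm a ^ 2"
    by (rule n_sub[OF a2])
  finally have e2: "norm (of_nat d * z ^ (d - 1)) * norm (deriv \<psi> v) =
      norm (deriv \<phi> 0) / (1 - norm a ^ 2) * (of_nat d * norm v ^ (d - 1))" .
  define q where "q = norm v ^ 2"
  have q: "0 \<le> q" "q < 1" using v by (auto simp: q_def abs_square_less_1)
  have n1: "norm (1 - complex_of_real (norm v ^ 2)) = 1 - q"
    using n_sub q by (simp only: q_def)
  have aq: "norm a ^ 2 = q ^ d" by (simp add: na q_def power_mult[symmetric] mult.commute)
  have qd: "1 - q ^ d > 0" using q d by (simp add: power_less_one_iff)
  \<comment> \<open>Bernoulli gives \<open>1 - q ^ d \<le> d * (1 - q)\<close>, so the factor left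
    over from the two recentrings is at least 1.\<close>
  have "1 + real d * (q - 1) \<le> (1 + (q - 1)) ^ d" by (rule Bernoulli_inequality) (use q in auto)
  then have bern: "1 \<le> real d * (1 - q) / (1 - q ^ d)" using qd by (simp add: field_simps)
  have "norm (of_nat d * z ^ (d - 1)) * norm (deriv \<eta> 0) =
      norm (deriv \<phi> 0) / (1 - q ^ d) * (of_nat d * norm v ^ (d - 1)) * (1 - q)"
    unfolding \<eta>d norm_mult[of "deriv \<psi> v"] n1 using e2 aq by (simp add: mult.assoc[symmetric])
  also have "\<dots> = norm v ^ (d - 1) * norm (deriv \<phi> 0) * (real d * (1 - q) / (1 - q ^ d))" by simp
  also have "\<dots> \<ge> norm v ^ (d - 1) * norm (deriv \<phi> 0) * 1"
    by (rule mult_left_mono[OF bern]) simp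
  finally have ineq: "norm (of_nat d * z ^ (d - 1)) * norm (deriv \<eta> 0) \<ge> norm v ^ (d - 1) * norm (deriv \<phi> 0)"
    by simp
  show ?thesis
  proof (rule that[of \<eta> \<psi> v])
    show "\<eta> holomorphic_on ball 0 1" unfolding \<eta>_def
      by (rule holomorphic_on_compose_gen[OF Chol \<psi>(1)]) (use CD in blast)
    show "inj_on \<eta> (ball 0 1)" unfolding \<eta>_def
      by (rule comp_inj_on[OF Cinj]) (rule inj_on_subset[OF \<psi>(2)], use CD in blast)
    show "\<eta> 0 = z" by (simp add: \<eta>_def C0 \<psi>v)
    show "\<eta> u ^ d + c \<in> \<phi> ` ball 0 1" if "u \<in> ball 0 1" for u
      using \<psi>im[OF CD[OF that]] by (simp add: \<eta>_def)
  qed (use \<psi> \<psi>v \<psi>im v ineq in auto)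
qed

section \<open>Trapped discs and attracting cycles\<close>

lemma funpow_holomorphic:
  assumes "f holomorphic_on UNIV"
  shows "(f ^^ n) holomorphic_on UNIV"
proof (induction n)
  case 0
  then show ?case by (simp add: id_def)
next
  case (Suc n)
  show ?case
    using holomorphic_on_compose_gen[OF Suc assms] by (simp add: o_def)
qed

lemma funpow_add_apply: fixes f :: "'a \<Rightarrow> 'a" shows "(f ^^ m) ((f ^^ n) x) = (f ^^ (m + n)) x"
  by (simp add: funpow_add)

lemma funpow_mult_apply: fixes f :: "'a \<Rightarrow> 'a" shows "((f ^^ m) ^^ n) x = (f ^^ (m * n)) x"
  by (simp add: funpow_mult)

text \<open>Moving the fixed point to the origin by a disc automorphism turns the Schwarz lemma into a
  contraction estimate.\<close>

lemma disc_strict_self_map_fixpoint: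
  assumes hol: "h holomorphic_on ball 0 1" and q': "q' < 1"
    and im: "\<And>u. u \<in> ball 0 1 \<Longrightarrow> h u \<in> ball 0 q'"
  obtains u0 where "u0 \<in> ball 0 1" "h u0 = u0" "norm (deriv h u0) < 1"
    "\<And>u. u \<in> ball 0 1 \<Longrightarrow> (\<lambda>n. (h ^^ n) u) \<longlonglongrightarrow> u0"
proof -
  have q'0: "q' > 0" using im[of 0] by (auto intro: le_less_trans[OF norm_ge_zero])
  have sub: "cball 0 q' \<subseteq> ball (0::complex) 1" using q' by auto
  obtain u0 where u0: "u0 \<in> cball 0 q'" "h u0 = u0"
  proof (rule brouwer[of "cball 0 q'" h])
    show "continuous_on (cball 0 q') h"
      using hol sub holomorphic_on_imp_continuous_on continuous_on_subset by blast
    show "h \<in> cball 0 q' \<rightarrow> cball 0 q'" using im sub by fastforce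
  qed (use q'0 in auto)
  have u0D: "u0 \<in> ball 0 1" using u0 sub by blast
  then have n0: "norm u0 < 1" by simp
  define A where "A = Moebius_function 0 u0"
  define B where "B = Moebius_function 0 (-u0)"
  have Ahol: "A holomorphic_on ball 0 1" and Bhol: "B holomorphic_on ball 0 1"
    unfolding A_def B_def using n0 by (auto intro: Moebius_function_holomorphic)
  have AD: "A u \<in> ball 0 1" and BD: "B u \<in> ball 0 1" if "u \<in> ball 0 1" for u
    unfolding A_def B_def using that n0 Moebius_function_norm_lt_1 by auto
  have AB: "A (B u) = u" and BA: "B (A u) = u" if "u \<in> ball 0 1" for u
    unfolding A_def B_def using that n0 Moebius_function_compose by auto
  have A0: "A u0 = 0" and B0: "B 0 = u0"
    by (simp_all add: A_def B_def Moebius_function_eq_zero Moebius_function_of_zero)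
  have "\<exists>x\<in>cball 0 q'. \<forall>y\<in>cball 0 q'. norm (A y) \<le> norm (A x)"
    by (rule continuous_attains_sup)
       (use q'0 Ahol sub in \<open>auto intro!: continuous_on_norm
          intro: holomorphic_on_imp_continuous_on holomorphic_on_subset\<close>)
  then obtain x where x: "x \<in> cball 0 q'" "\<And>y. y \<in> cball 0 q' \<Longrightarrow> norm (A y) \<le> norm (A x)" by blast
  \<comment> \<open>The midpoint between 1 and the maximum of \<open>norm (A y)\<close> over the
    compact disc: strictly above the maximum, below 1, and positive.\<close>
  define q where "q = (1 + norm (A x)) / 2"
  have q: "0 < q" "q < 1" "norm (A x) < q"
    using AD[of x] x(1) sub by (auto simp: q_def add_pos_nonneg)
  define k where "k u = A (h (B u))" for u
  have khol: "k holomorphic_on ball 0 1"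
  proof -
    have "(h \<circ> B) holomorphic_on ball 0 1"
      by (rule holomorphic_on_compose_gen[OF Bhol hol]) (use BD in blast)
    then have "(A \<circ> (h \<circ> B)) holomorphic_on ball 0 1"
      by (rule holomorphic_on_compose_gen[OF _ Ahol]) (use BD im sub in fastforce)
    then show ?thesis by (simp add: k_def[abs_def] o_def)
  qed
  have k0: "k 0 = 0" using A0 B0 u0 by (simp add: k_def)
  have kq: "norm (k u) < q" if "u \<in> ball 0 1" for u
    using x(2)[of "h (B u)"] im[OF BD[OF that]] q(3) by (simp add: k_def)
  have hk: "(\<lambda>u. k u / q) holomorphic_on ball 0 1"
    using q by (intro holomorphic_intros khol) auto
  have S1: "norm (k u / q) < 1" if "norm u < 1" for u
    using kq[of u] that q by (simp add: norm_divide)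
  have S2: "norm (k u) \<le> q * norm u" if "u \<in> ball 0 1" for u
    using Schwarz_Lemma(1)[OF hk _ S1, of u] that q k0 by (simp add: norm_divide divide_le_eq mult.commute)
  have kd: "(k has_field_derivative deriv k 0) (at 0)"
    by (rule holomorphic_derivI[OF khol]) auto
  have "deriv (\<lambda>u. k u / q) 0 = deriv k 0 / q"
    by (rule DERIV_imp_deriv) (use kd q in \<open>auto intro!: derivative_eq_intros\<close>)
  then have "norm (deriv k 0 / q) \<le> 1"
    using Schwarz_Lemma(2)[OF hk _ S1, of 0] k0 by simp
  then have kd1: "norm (deriv k 0) < 1" using q by (simp add: norm_divide)
  have Bd: "(B has_field_derivative deriv B 0) (at 0)"
    by (rule holomorphic_derivI[OF Bhol]) auto
  have hd: "(h has_field_derivative deriv h u0) (at u0)"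
    by (rule holomorphic_derivI[OF hol]) (use u0D in auto)
  have Ad: "(A has_field_derivative deriv A u0) (at u0)"
    by (rule holomorphic_derivI[OF Ahol]) (use u0D in auto)
  have "((\<lambda>u. h (B u)) has_field_derivative deriv h u0 * deriv B 0) (at 0)"
    by (rule DERIV_chain2[where f=h]) (use hd Bd B0 in auto)
  then have "(k has_field_derivative deriv A u0 * (deriv h u0 * deriv B 0)) (at 0)"
    unfolding k_def by (rule DERIV_chain2[where f=A, rotated]) (use Ad B0 u0 in auto)
  then have e1: "deriv k 0 = deriv A u0 * (deriv h u0 * deriv B 0)" by (rule DERIV_imp_deriv)
  \<comment> \<open>As \<open>A\<close> inverts \<open>B\<close>, their derivatives cancel, so
    conjugation preserves the multiplier.\<close>
  have "((\<lambda>u. A (B u)) has_field_derivative deriv A u0 * deriv B 0) (at 0)"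
    by (rule DERIV_chain2[where f=A]) (use Ad Bd B0 in auto)
  then have "((\<lambda>u. u) has_field_derivative deriv A u0 * deriv B 0) (at 0)"
    by (rule has_field_derivative_transform_within[where d=1]) (auto intro: AB)
  then have "deriv A u0 * deriv B 0 = 1" using DERIV_ident DERIV_unique by blast
  then have "deriv k 0 = deriv h u0" using e1 by (simp add: algebra_simps)
  then have hd1: "norm (deriv h u0) < 1" using kd1 by simp
  have hD: "(h ^^ n) u \<in> ball 0 1" if "u \<in> ball 0 1" for n u
    using that by (induction n) (use im sub in fastforce)+
  have con: "norm (A ((h ^^ n) u)) \<le> q ^ n" if u: "u \<in> ball 0 1" for n u
  proof (induction n)
    case 0
    show ?case using AD[OF u] by simp
  next
    case (Suc n)
    have "A ((h ^^ Suc n) u) = k (A ((h ^^ n) u))"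
      using hD[OF u, of n] by (simp add: k_def BA)
    then have "norm (A ((h ^^ Suc n) u)) \<le> q * norm (A ((h ^^ n) u))"
      using S2[OF AD[OF hD[OF u]]] by simp
    also have "\<dots> \<le> q * q ^ n" using Suc q by (intro mult_left_mono) auto
    finally show ?case by simp
  qed
  have lim: "(\<lambda>n. (h ^^ n) u) \<longlonglongrightarrow> u0" if u: "u \<in> ball 0 1" for u
  proof -
    have "(\<lambda>n. q ^ n) \<longlonglongrightarrow> 0" using q by (intro LIMSEQ_realpow_zero) auto
    then have "(\<lambda>n. A ((h ^^ n) u)) \<longlonglongrightarrow> 0"
      by (rule Lim_null_comparison[rotated]) (use con[OF u] in auto)
    moreover have "isCont B 0" using Bd DERIV_isCont by blast
    ultimately have "(\<lambda>n. B (A ((h ^^ n) u))) \<longlonglongrightarrow> B 0" by (rule isCont_tendsto_compose[rotated])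
    then show ?thesis using hD[OF u] by (simp add: BA B0)
  qed
  show ?thesis by (rule that[OF u0D u0(2) hd1 lim])
qed

text \<open>Rescaled to the unit disc, \<open>f ^^ m\<close> is a strict self-map, whose fixed point
  yields an attracting cycle. Convergence along times in one residue class modulo \<open>m\<close>
  extends to all times by continuity of the finitely many iterates \<open>f ^^ j\<close> with
  \<open>j < m\<close>.\<close>

lemma trapping_disc_in_attracting_basin:
  assumes f: "f holomorphic_on UNIV" and m: "m > 0" and R: "R' < R"
    and im: "(f ^^ m) ` ball a R \<subseteq> ball a R'" and z: "(f ^^ k) z \<in> ball a R"
  shows "in_attracting_basin f z"
proof -
  have Rp: "R > 0" using z by (auto intro: le_less_trans[OF zero_le_dist])
  define T where "T u = a + of_real R * u" for u :: complex
  define T' where "T' x = (x - a) / of_real R" for x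
  have TT': "T (T' x) = x" "T' (T u) = u" for x u using Rp by (auto simp: T_def T'_def)
  have TB: "T u \<in> ball a R" if "u \<in> ball 0 1" for u
    using that Rp by (simp add: T_def dist_norm norm_mult)
  have T'B: "T' x \<in> ball 0 r" if "x \<in> ball a (r * R)" for r x
    using that Rp by (simp add: T'_def dist_norm norm_divide norm_minus_commute divide_less_eq)
  define g where "g = f ^^ m"
  have ghol: "g holomorphic_on A" for A
    using funpow_holomorphic[OF f, of m] holomorphic_on_subset by (auto simp: g_def)
  define h where "h u = T' (g (T u))" for u
  have hhol: "h holomorphic_on ball 0 1"
  proof -
    have "(g \<circ> T) holomorphic_on ball 0 1"
      by (rule holomorphic_on_compose[OF _ ghol]) (auto simp: T_def[abs_def] intro!: holomorphic_intros)
    then show ?thesis using Rp unfolding h_def T'_def o_def by (intro holomorphic_intros) auto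
  qed
  have him: "h u \<in> ball 0 (R' / R)" if "u \<in> ball 0 1" for u
  proof -
    have "g (T u) \<in> ball a R'" using im TB[OF that] unfolding g_def by blast
    then show ?thesis using T'B[of "g (T u)" "R' / R"] Rp by (simp add: h_def)
  qed
  obtain u0 where u0: "u0 \<in> ball 0 1" "h u0 = u0" "norm (deriv h u0) < 1"
    "\<And>u. u \<in> ball 0 1 \<Longrightarrow> (\<lambda>n. (h ^^ n) u) \<longlonglongrightarrow> u0"
    using disc_strict_self_map_fixpoint[OF hhol _ him] R Rp by auto
  define z0 where "z0 = T u0"
  have gz0: "g z0 = z0" using u0(2) TT' by (metis h_def z0_def)
  have gd: "(g has_field_derivative deriv g z0) (at z0)"
    by (rule holomorphic_derivI[OF ghol[of UNIV]]) auto
  have Td: "(T has_field_derivative of_real R) (at u0)"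
    unfolding T_def[abs_def] by (auto intro!: derivative_eq_intros)
  have "((\<lambda>u. g (T u)) has_field_derivative deriv g z0 * of_real R) (at u0)"
    by (rule DERIV_chain2[where f=g, OF _ Td]) (use gd in \<open>simp add: z0_def\<close>)
  then have "((\<lambda>u. (g (T u) - a) / of_real R) has_field_derivative (deriv g z0 * of_real R - 0) / of_real R) (at u0)"
    by (intro DERIV_cdivide DERIV_diff DERIV_const)
  then have "(h has_field_derivative deriv g z0) (at u0)"
    using Rp by (simp add: h_def[abs_def] T'_def)
  then have "norm (deriv g z0) < 1" using u0(3) DERIV_imp_deriv by fastforce
  then have att: "attracting_cycle f z0 m"
    using gz0 m by (simp add: attracting_cycle_def g_def)
  define y where "y = (f ^^ k) z"
  have gT: "(g ^^ n) y = T ((h ^^ n) (T' y))" for n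
    by (induction n) (simp_all add: TT' h_def)
  have "T' y \<in> ball 0 1" using T'B[of y 1] z by (simp add: y_def)
  then have "(\<lambda>n. T ((h ^^ n) (T' y))) \<longlonglongrightarrow> T u0"
    using u0(4) unfolding T_def by (intro tendsto_intros) auto
  then have lim: "(\<lambda>n. (g ^^ n) y) \<longlonglongrightarrow> z0" by (simp add: gT z0_def)
  have "(\<lambda>n. infdist ((f ^^ n) z) (cycle_orbit f z0 m)) \<longlonglongrightarrow> 0"
  proof (rule LIMSEQ_I)
    fix e :: real assume e: "e > 0"
    have "\<forall>\<^sub>F i in sequentially. dist ((f ^^ j) ((g ^^ i) y)) ((f ^^ j) z0) < e" for j
    proof -
      have "isCont (f ^^ j) z0"
        using holomorphic_on_imp_continuous_on[OF funpow_holomorphic[OF f, of j]]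
        by (simp add: continuous_on_eq_continuous_at)
      then have "(\<lambda>i. (f ^^ j) ((g ^^ i) y)) \<longlonglongrightarrow> (f ^^ j) z0"
        using lim by (rule isCont_tendsto_compose)
      then show ?thesis using e tendstoD by blast
    qed
    then have "\<forall>\<^sub>F i in sequentially. \<forall>j\<in>{..<m}. dist ((f ^^ j) ((g ^^ i) y)) ((f ^^ j) z0) < e"
      by (intro eventually_ball_finite) auto
    then obtain I where I: "\<And>i j. i \<ge> I \<Longrightarrow> j < m \<Longrightarrow> dist ((f ^^ j) ((g ^^ i) y)) ((f ^^ j) z0) < e"
      by (auto simp: eventually_sequentially)
    show "\<exists>no. \<forall>n\<ge>no. norm (infdist ((f ^^ n) z) (cycle_orbit f z0 m) - 0) < e"
    proof (intro exI allI impI)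
      fix n assume n: "n \<ge> k + m * I"
      \<comment> \<open>\<open>i\<close> counts applications of \<open>g\<close> after time
        \<open>k\<close>; the remainder \<open>j\<close> selects the cycle point
        \<open>(f ^^ j) z0\<close> to compare with.\<close>
      define i j where "i = (n - k) div m" and "j = (n - k) mod m"
      have nij: "n = j + (m * i + k)" using n by (simp add: i_def j_def)
      have "i \<ge> I" using n m by (simp add: i_def less_eq_div_iff_mult_less_eq mult.commute)
      moreover have j: "j < m" using m by (simp add: j_def)
      ultimately have "dist ((f ^^ j) ((g ^^ i) y)) ((f ^^ j) z0) < e" by (rule I)
      moreover have "(f ^^ j) ((g ^^ i) y) = (f ^^ n) z"
        unfolding g_def y_def funpow_mult_apply funpow_add_apply nij by simp
      moreover have "(f ^^ j) z0 \<in> cycle_orbit f z0 m" using j by (auto simp: cycle_orbit_def)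
      ultimately have "infdist ((f ^^ n) z) (cycle_orbit f z0 m) < e"
        by (metis infdist_le le_less_trans)
      then show "norm (infdist ((f ^^ n) z) (cycle_orbit f z0 m) - 0) < e"
        by (simp add: infdist_nonneg)
    qed
  qed
  then show ?thesis using att by (auto simp: in_attracting_basin_def)
qed

section \<open>Local expansion and suffix maxima\<close>

text \<open>Writing \<open>z = w * (1 + t)\<close> reduces this to the difference quotient of
  \<open>(1 + t) ^ d\<close> at 0, which tends to \<open>d < exp \<epsilon> * d\<close>. By this
  homogeneity one relative radius \<open>\<tau>\<close> serves all \<open>w\<close>.\<close>

lemma power_local_expansion:
  assumes "\<epsilon> > 0" "d > 0"
  obtains \<tau> :: real where "\<tau> > 0"
    "\<And>w z :: complex. norm (z - w) \<le> \<tau> * norm w \<Longrightarrow>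
      norm (z ^ d - w ^ d) \<le> exp \<epsilon> * (norm (of_nat d * w ^ (d - 1)) * norm (z - w))"
proof -
  have "((\<lambda>t. (1 + t) ^ d) has_field_derivative of_nat d) (at (0::complex))"
    by (auto intro!: derivative_eq_intros)
  then have "((\<lambda>h. ((1 + (0 + h)) ^ d - (1 + 0) ^ d) / h) \<longlongrightarrow> of_nat d) (at (0::complex))"
    by (rule DERIV_D)
  then have "((\<lambda>h. norm (((1 + (0 + h)) ^ d - (1 + 0) ^ d) / h)) \<longlongrightarrow> norm (of_nat d :: complex)) (at (0::complex))"
    by (rule tendsto_norm)
  moreover have "norm (of_nat d :: complex) < exp \<epsilon> * real d" using assms by simp
  ultimately have "\<forall>\<^sub>F h in at (0::complex). norm (((1 + (0 + h)) ^ d - (1 + 0) ^ d) / h) < exp \<epsilon> * real d"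
    by (rule order_tendstoD(2))
  then obtain \<tau> where \<tau>: "\<tau> > 0"
    "\<And>h::complex. h \<noteq> 0 \<Longrightarrow> dist h 0 < \<tau> \<Longrightarrow> norm (((1 + h) ^ d - 1) / h) < exp \<epsilon> * real d"
    by (auto simp: eventually_at)
  show ?thesis
  proof (rule that[of "\<tau> / 2"])
    fix w z :: complex assume le: "norm (z - w) \<le> \<tau> / 2 * norm w"
    show "norm (z ^ d - w ^ d) \<le> exp \<epsilon> * (norm (of_nat d * w ^ (d - 1)) * norm (z - w))"
    proof (cases "w = 0 \<or> z = w")
      case True
      then show ?thesis using le by auto
    next
      case False
      define t where "t = (z - w) / w"
      have t: "t \<noteq> 0" "z = w * (1 + t)" "z - w = w * t" using False by (auto simp: t_def field_simps)
      have "norm w * norm t \<le> norm w * (\<tau> / 2)" using le unfolding t(3) norm_mult by (simp add: mult.commute)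
      then have "norm t \<le> \<tau> / 2" by (rule mult_left_le_imp_le) (use False in simp)
      then have "norm (((1 + t) ^ d - 1) / t) < exp \<epsilon> * real d" using t(1) \<tau> by (intro \<tau>(2)) auto
      then have "norm ((1 + t) ^ d - 1) \<le> exp \<epsilon> * real d * norm t"
        using t(1) by (simp add: norm_divide divide_less_eq)
      then have "norm w ^ d * norm ((1 + t) ^ d - 1) \<le> norm w ^ d * (exp \<epsilon> * real d * norm t)"
        by (rule mult_left_mono) simp
      moreover have "z ^ d - w ^ d = w ^ d * ((1 + t) ^ d - 1)"
        unfolding t(2) power_mult_distrib by (simp add: right_diff_distrib)
      moreover have "norm w ^ d = norm w ^ (d - 1) * norm w" using assms(2) by (cases d) auto
      ultimately show ?thesis unfolding t(3) by (simp add: norm_mult norm_power mult_ac)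
    qed
  qed (use \<tau> in simp)
qed

text \<open>The chosen times are the last ones at which \<open>T\<close> is above \<open>- i * L * A\<close>.\<close>

lemma suffix_maxima:
  fixes T :: "nat \<Rightarrow> real"
  assumes T0: "T 0 = 0" and step: "\<And>k. k < n \<Longrightarrow> T (Suc k) \<ge> T k - A" and A: "A > 0"
    and Tn: "T n < - (real P * real L * A)" and L: "L > 0"
  obtains m :: "nat \<Rightarrow> nat" where "\<And>i. i \<le> P \<Longrightarrow> m i \<le> n"
    "\<And>i k. i \<le> P \<Longrightarrow> m i \<le> k \<Longrightarrow> k \<le> n \<Longrightarrow> T k \<le> T (m i)"
    "\<And>i j. i < j \<Longrightarrow> j \<le> P \<Longrightarrow> m i + L \<le> m j"
proof -
  define S where "S i = {k. k \<le> n \<and> T k \<ge> - (real i * real L * A)}" for i :: nat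
  define m where "m i = Max (S i)" for i
  have fin: "finite (S i)" for i by (simp add: S_def)
  have S0: "0 \<in> S i" for i using T0 A by (auto simp: S_def)
  have mS: "m i \<in> S i" for i unfolding m_def using fin S0[of i] by (intro Max_in) auto
  have mmax: "k \<le> m i" if "k \<in> S i" for k i unfolding m_def using fin that by (intro Max_ge)
  have m1: "m i \<le> n" "T (m i) \<ge> - (real i * real L * A)" for i using mS[of i] by (auto simp: S_def)
  have m2: "T k < - (real i * real L * A)" if "m i < k" "k \<le> n" for i k
    using mmax[of k i] that by (force simp: S_def)
  have thr: "T n < - (real i * real L * A)" if "i \<le> P" for i
  proof -
    have "real i * real L * A \<le> real P * real L * A" using that A by (intro mult_right_mono) auto
    then show ?thesis using Tn by linarith
  qed
  have mn: "m i < n" if "i \<le> P" for i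
    using m1[of i] thr[OF that] by (cases "m i = n") auto
  have drop: "T (a + k) \<ge> T a - A * real k" if "a + k \<le> n" for a k
    using that
  proof (induction k)
    case (Suc k)
    then show ?case using step[of "a + k"] by (simp add: algebra_simps)
  qed simp
  show ?thesis
  proof (rule that[of m])
    show "m i \<le> n" for i by (rule m1)
    show "T k \<le> T (m i)" if "m i \<le> k" "k \<le> n" for i k
      using m2[of i k] m1(2)[of i] that by (cases "m i = k") auto
    show "m i + L \<le> m j" if ij: "i < j" "j \<le> P" for i j
    proof -
      have LA: "real (Suc i) * real L * A \<le> real j * real L * A"
        using ij A by (intro mult_right_mono) auto
      have "m i \<in> S j"
      proof -
        have "real i * real L * A \<le> real j * real L * A" using ij A by (intro mult_right_mono) auto
        then show ?thesis using m1[of i] by (auto simp: S_def)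
      qed
      then have le: "m i \<le> m j" by (rule mmax)
      \<comment> \<open>Just after the last time above the threshold, \<open>T\<close> is below it,
        so \<open>T (m j)\<close> exceeds the threshold by less than one step \<open>A\<close>. This
        spare step gives \<open>L < m j - m i + 1\<close>, and integrality removes the 1.\<close>
      have "T (m j) \<le> T (Suc (m j)) + A" using step[of "m j"] mn[OF ij(2)] by simp
      also have "\<dots> < - (real j * real L * A) + A" using m2[of j "Suc (m j)"] mn[OF ij(2)] by simp
      finally have 1: "T (m j) < - (real j * real L * A) + A" .
      have 2: "T (m j) \<ge> T (m i) - A * real (m j - m i)"
        using drop[of "m i" "m j - m i"] le m1(1)[of j] by simp
      have "A * real L < A * (real (m j - m i) + 1)"
        using 1 2 m1(2)[of i] LA by (simp add: algebra_simps)
      then have "real L < real (m j - m i) + 1" using A by simp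
      then show ?thesis using le by linarith
    qed
  qed
qed

section \<open>Unicritical polynomials\<close>

locale unicritical =
  fixes d :: nat and c :: complex
  assumes d_ge_2: "d \<ge> 2" and not_attracted: "\<not> in_attracting_basin (\<lambda>z. z ^ d + c) c"
begin

definition f :: "complex \<Rightarrow> complex" where "f z = z ^ d + c"

text \<open>The chain-rule product for the derivative of \<open>f ^^ n\<close>;
  \<open>deriv_iterate\<close> identifies it with \<open>deriv\<close>.\<close>

definition D :: "nat \<Rightarrow> complex \<Rightarrow> complex" where
  "D n z = (\<Prod>i<n. of_nat d * (f ^^ i) z ^ (d - 1))"

lemma f_0: "f 0 = c"
  using d_ge_2 by (simp add: f_def)

lemma f_holomorphic: "f holomorphic_on UNIV"
  unfolding f_def[abs_def] by (intro holomorphic_intros)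

lemma not_basin: "\<not> in_attracting_basin f c"
  using not_attracted by (simp add: f_def[abs_def])

text \<open>Apart from the non-periodicity of the critical point, this is how the hypothesis on
  \<open>c\<close> enters the estimates below.\<close>

lemma no_trapping_disc:
  assumes "m > 0" "R' < R" "(f ^^ k) c \<in> ball a R"
  shows "\<not> (f ^^ m) ` ball a R \<subseteq> ball a R'"
  using trapping_disc_in_attracting_basin[OF f_holomorphic assms(1,2) _ assms(3)] not_basin by blast

lemma has_field_derivative_iterate: "((f ^^ n) has_field_derivative D n z) (at z)"
proof (induction n)
  case 0
  then show ?case by (simp add: D_def id_def)
next
  case (Suc n)
  have "(f has_field_derivative of_nat d * (f ^^ n) z ^ (d - 1)) (at ((f ^^ n) z))"
    unfolding f_def[abs_def] by (auto intro!: derivative_eq_intros)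
  from DERIV_chain2[OF this Suc] show ?case by (simp add: D_def mult.commute o_def)
qed

lemma isCont_iterate: "isCont (f ^^ n) z"
  using has_field_derivative_iterate DERIV_isCont by blast

lemma deriv_iterate: "deriv (f ^^ n) z = D n z"
  by (rule DERIV_imp_deriv[OF has_field_derivative_iterate])

lemma D_add: "D (m + n) z = D m z * D n ((f ^^ m) z)"
proof -
  have "D (m + n) z = (\<Prod>i<m. of_nat d * (f ^^ i) z ^ (d - 1)) *
      (\<Prod>i\<in>{m..<m + n}. of_nat d * (f ^^ i) z ^ (d - 1))"
    unfolding D_def by (subst prod.union_disjoint[symmetric]) (auto intro!: prod.cong)
  also have "(\<Prod>i\<in>{m..<m + n}. of_nat d * (f ^^ i) z ^ (d - 1)) = D n ((f ^^ m) z)"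
    unfolding D_def funpow_add_apply
    by (rule prod.reindex_bij_witness[of _ "\<lambda>i. i + m" "\<lambda>i. i - m"]) auto
  finally show ?thesis by (simp add: D_def)
qed

lemma D_0 [simp]: "D 0 z = 1"
  by (simp add: D_def)

lemma D_1: "D (Suc 0) z = of_nat d * z ^ (d - 1)"
  by (simp add: D_def)

lemma D_Suc: "D (Suc n) z = D n z * (of_nat d * (f ^^ n) z ^ (d - 1))"
  by (simp add: D_def)

lemma D_Suc_left: "D (Suc n) z = of_nat d * z ^ (d - 1) * D n (f z)"
  using D_add[of 1 n z] by (simp add: D_1)

section \<open>Returns of the critical point\<close>

lemma critical_point_not_periodic:
  assumes "n > 0"
  shows "(f ^^ n) 0 \<noteq> 0"
proof
  assume per: "(f ^^ n) 0 = 0"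
  \<comment> \<open>A cycle through the critical point has multiplier 0, and it would contain the
    whole orbit of \<open>c = f 0\<close>.\<close>
  have "D n 0 = 0" using assms d_ge_2 by (cases n) (auto simp: D_Suc_left)
  then have "attracting_cycle f 0 n" using assms per by (simp add: attracting_cycle_def deriv_iterate)
  moreover have "(f ^^ k) c \<in> cycle_orbit f 0 n" for k
  proof -
    have "(f ^^ k) c = (f ^^ Suc k) 0" by (simp add: funpow_Suc_right f_0 del: funpow.simps)
    also have "\<dots> = (f ^^ (Suc k mod n)) 0" using funpow_mod_eq[OF per] by metis
    finally show ?thesis using assms by (force simp: cycle_orbit_def)
  qed
  ultimately have "in_attracting_basin f c"
    unfolding in_attracting_basin_def by (intro exI[of _ 0] exI[of _ n]) simp
  then show False using not_basin by blast
qed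

text \<open>The first \<open>N\<close> iterates of 0 are nonzero, so by continuity small discs about
  0 are moved off themselves for \<open>N\<close> steps. This makes close returns rare.\<close>

lemma return_time_large:
  obtains \<delta> where "\<delta> > 0" "\<And>p z. \<lbrakk>0 < p; p \<le> N; norm z < \<delta>\<rbrakk> \<Longrightarrow> norm ((f ^^ p) z) \<ge> \<delta>"
proof -
  have "\<exists>\<delta>>0. \<forall>p z. 0 < p \<longrightarrow> p \<le> N \<longrightarrow> norm z < \<delta> \<longrightarrow> norm ((f ^^ p) z) \<ge> \<delta>"
  proof (induction N)
    case 0
    show ?case by (intro exI[of _ 1]) auto
  next
    case (Suc N)
    then obtain \<delta> where \<delta>: "\<delta> > 0" "\<And>p z. \<lbrakk>0 < p; p \<le> N; norm z < \<delta>\<rbrakk> \<Longrightarrow> norm ((f ^^ p) z) \<ge> \<delta>"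
      by blast
    define e where "e = norm ((f ^^ Suc N) 0) / 2"
    have e: "e > 0" using critical_point_not_periodic[of "Suc N"] by (simp add: e_def del: funpow.simps)
    have "\<forall>e>0. \<exists>r>0. \<forall>z. dist z 0 < r \<longrightarrow> dist ((f ^^ Suc N) z) ((f ^^ Suc N) 0) < e"
      using isCont_iterate[where n="Suc N" and z=0] unfolding continuous_at_eps_delta .
    from this[rule_format, OF e] obtain r
      where r: "r > 0" "\<And>z. dist z 0 < r \<Longrightarrow> dist ((f ^^ Suc N) z) ((f ^^ Suc N) 0) < e"
      by auto
    show ?case
    proof (intro exI[of _ "min \<delta> (min r e)"] conjI allI impI)
      fix p and z :: complex assume p: "0 < p" "p \<le> Suc N" and z: "norm z < min \<delta> (min r e)"
      show "norm ((f ^^ p) z) \<ge> min \<delta> (min r e)"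
      proof (cases "p = Suc N")
        case True
        have "dist ((f ^^ Suc N) z) ((f ^^ Suc N) 0) < e" using r(2) z by simp
        then have "norm ((f ^^ Suc N) z) \<ge> e"
          using norm_triangle_ineq2[of "(f ^^ Suc N) 0" "(f ^^ Suc N) z"]
          unfolding e_def dist_norm norm_minus_commute[of "(f ^^ Suc N) 0"] by linarith
        then show ?thesis using True by simp
      next
        case False
        then show ?thesis using \<delta>(2)[of p z] p z by (simp add: min_le_iff_disj)
      qed
    qed (use \<delta> r e in auto)
  qed
  then show ?thesis using that by blast
qed

definition returns :: "real \<Rightarrow> nat \<Rightarrow> nat set" where
  "returns r s = {p \<in> {1..s}. norm ((f ^^ p) 0) < r}"

lemma finite_returns [simp]: "finite (returns r s)"
  by (simp add: returns_def)

text \<open>Two return times differ by more than \<open>N\<close>: otherwise \<open>gap\<close>,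
  applied at the earlier return, contradicts the later one. Removing the last return thus leaves
  only returns up to \<open>s - Suc N\<close>, to which induction applies.\<close>

lemma card_returns:
  assumes gap: "\<And>p z. \<lbrakk>0 < p; p \<le> N; norm z < r\<rbrakk> \<Longrightarrow> norm ((f ^^ p) z) \<ge> r" and "r > 0"
  shows "card (returns r s) * Suc N \<le> s"
proof (induction s rule: less_induct)
  case (less s)
  show ?case
  proof (cases "s \<in> returns r s")
    case False
    then have "returns r s = returns r (s - 1)"
      by (cases s) (auto simp: returns_def le_Suc_eq)
    then show ?thesis
      using less[of "s - 1"] by (cases "s = 0") (auto simp: returns_def)
  next
    case True
    then have s: "0 < s" "norm ((f ^^ s) 0) < r" by (auto simp: returns_def)
    have sN: "N < s" using gap[of s 0] s \<open>r > 0\<close> by force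
    have "returns r s \<subseteq> insert s (returns r (s - Suc N))"
    proof
      fix p assume p: "p \<in> returns r s"
      then have p1: "0 < p" "p \<le> s" "norm ((f ^^ p) 0) < r" by (auto simp: returns_def)
      show "p \<in> insert s (returns r (s - Suc N))"
      proof (rule ccontr)
        assume "p \<notin> insert s (returns r (s - Suc N))"
        then have p2: "p < s" "s - p \<le> N" using p1 by (auto simp: returns_def)
        have "norm ((f ^^ (s - p)) ((f ^^ p) 0)) \<ge> r" by (rule gap) (use p1 p2 in auto)
        then show False using s p2 by (simp add: funpow_add_apply)
      qed
    qed
    then have "card (returns r s) \<le> card (insert s (returns r (s - Suc N)))"
      by (intro card_mono) auto
    also have "\<dots> \<le> Suc (card (returns r (s - Suc N)))" by (rule card_insert_le_m1) auto
    finally have "card (returns r s) * Suc N \<le> Suc (card (returns r (s - Suc N))) * Suc N"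
      by (rule mult_right_mono) simp
    also have "\<dots> \<le> s" using less[of "s - Suc N"] sN by simp
    finally show ?thesis .
  qed
qed

subsection \<open>Closest approaches to the critical point\<close>

text \<open>The product on the right of the last inequality compares conformal radii of the pullback
  and of the target disc. It starts at \<open>\<rho> / 2\<close>, is preserved when
  \<open>\<phi>\<close> omits \<open>c\<close>, and otherwise drops by at most the factor
  \<open>\<kappa> ^ (d - 1)\<close>. The latter happens only when \<open>i\<close> passes a return
  time, whence the exponent.\<close>

lemma univalent_pullback:
  fixes \<kappa> \<rho> :: real
  assumes \<kappa>: "0 < \<kappa>" "\<kappa> < 1"
    and koebe: "\<forall>\<psi> v. \<psi> holomorphic_on ball 0 1 \<and> inj_on \<psi> (ball 0 1) \<and> \<psi> 0 = 0 \<and>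
        \<not> ball 0 (2 * \<rho>) \<subseteq> \<psi> ` ball 0 1 \<and> norm (\<psi> v) \<ge> \<rho> \<longrightarrow> \<kappa> \<le> norm v"
    and \<rho>: "\<rho> > 0" and away: "\<And>j. j < s \<Longrightarrow> norm ((f ^^ j) x) \<ge> \<rho>" and s: "norm ((f ^^ s) x) = \<rho>"
    and "i \<le> s"
  shows "\<exists>\<phi>. \<phi> holomorphic_on ball 0 1 \<and> inj_on \<phi> (ball 0 1) \<and> \<phi> 0 = (f ^^ (s - i)) x \<and>
      (\<forall>u\<in>ball 0 1. (f ^^ i) (\<phi> u) \<in> ball ((f ^^ s) x) (\<rho> / 2)) \<and>
      \<kappa> ^ ((d - 1) * card (returns (2 * \<rho>) i)) * (\<rho> / 2)
        \<le> norm (D i ((f ^^ (s - i)) x)) * norm (deriv \<phi> 0)"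
  using \<open>i \<le> s\<close>
proof (induction i)
  case 0
  define \<phi> where "\<phi> u = (f ^^ s) x + of_real (\<rho> / 2) * u" for u
  have "(\<phi> has_field_derivative of_real (\<rho> / 2)) (at 0)"
    unfolding \<phi>_def[abs_def] by (auto intro!: derivative_eq_intros)
  then have \<phi>d: "deriv \<phi> 0 = of_real (\<rho> / 2)"
    by (rule DERIV_imp_deriv)
  show ?case
  proof (intro exI[of _ \<phi>] conjI ballI)
    show "\<phi> holomorphic_on ball 0 1" unfolding \<phi>_def[abs_def] by (intro holomorphic_intros)
    show "inj_on \<phi> (ball 0 1)" using \<rho> by (intro inj_onI) (simp add: \<phi>_def)
    show "(f ^^ 0) (\<phi> u) \<in> ball ((f ^^ s) x) (\<rho> / 2)" if "u \<in> ball 0 1" for u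
      using that \<rho> by (simp add: \<phi>_def dist_norm norm_mult norm_divide)
    show "\<phi> 0 = (f ^^ (s - 0)) x" by (simp add: \<phi>_def)
  qed (use \<rho> in \<open>auto simp: returns_def \<phi>d norm_divide\<close>)
next
  case (Suc i)
  then have i: "i < s" by simp
  define z where "z = (f ^^ (s - Suc i)) x"
  define y where "y = (f ^^ s) x"
  have y: "norm y = \<rho>" using s by (simp add: y_def)
  have si: "s - i = Suc (s - Suc i)" using i by simp
  have fz: "f z = (f ^^ (s - i)) x" unfolding z_def si by simp
  have z_ge: "norm z \<ge> \<rho>" unfolding z_def by (rule away) (use i in simp)
  then have z: "z \<noteq> 0" using \<rho> by auto
  have d0: "d > 0" using d_ge_2 by simp
  let ?h = "\<lambda>i. card (returns (2 * \<rho>) i)"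
  obtain \<phi> where \<phi>: "\<phi> holomorphic_on ball 0 1" "inj_on \<phi> (ball 0 1)" "\<phi> 0 = f z"
    "\<And>u. u \<in> ball 0 1 \<Longrightarrow> (f ^^ i) (\<phi> u) \<in> ball y (\<rho> / 2)"
    "\<kappa> ^ ((d - 1) * ?h i) * (\<rho> / 2) \<le> norm (D i (f z)) * norm (deriv \<phi> 0)"
    using Suc.IH i unfolding fz y_def by auto
  have D_z: "norm (D (Suc i) z) = norm (of_nat d * z ^ (d - 1)) * norm (D i (f z))"
    by (simp only: D_Suc_left norm_mult)
  have \<phi>0: "\<phi> 0 = z ^ d + c" using \<phi>(3) by (simp add: f_def)
  have land: "(f ^^ Suc i) w \<in> ball y (\<rho> / 2)" if "w ^ d + c \<in> \<phi> ` ball 0 1" for w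
  proof -
    from that obtain u where u: "u \<in> ball 0 1" "\<phi> u = w ^ d + c" by force
    then show ?thesis using \<phi>(4)[OF u(1)] by (simp add: funpow_Suc_right f_def del: funpow.simps)
  qed
  show ?case
  proof (cases "c \<in> \<phi> ` ball 0 1")
    case False
    obtain \<eta> where \<eta>: "\<eta> holomorphic_on ball 0 1" "inj_on \<eta> (ball 0 1)" "\<eta> 0 = z"
      "\<And>u. u \<in> ball 0 1 \<Longrightarrow> \<eta> u ^ d + c = \<phi> u"
      by (rule lift_unramified[OF \<phi>(1,2) False \<phi>0 d0]) (rule that; assumption)
    have \<eta>d: "(\<eta> has_field_derivative deriv \<eta> 0) (at 0)"
      by (rule holomorphic_derivI[OF \<eta>(1)]) auto
    have "(\<phi> has_field_derivative of_nat d * z ^ (d - 1) * deriv \<eta> 0) (at 0)"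
    proof (rule has_field_derivative_transform_within_open[where S = "ball 0 1"])
      show "((\<lambda>u. \<eta> u ^ d + c) has_field_derivative of_nat d * z ^ (d - 1) * deriv \<eta> 0) (at 0)"
        by (auto intro!: derivative_eq_intros \<eta>d simp: \<eta>(3))
    qed (use \<eta>(4) in auto)
    then have "deriv \<phi> 0 = of_nat d * z ^ (d - 1) * deriv \<eta> 0" by (rule DERIV_imp_deriv)
    then have "norm (deriv \<phi> 0) = norm (of_nat d * z ^ (d - 1)) * norm (deriv \<eta> 0)"
      by (simp only: norm_mult)
    then have e: "norm (D (Suc i) z) * norm (deriv \<eta> 0) = norm (D i (f z)) * norm (deriv \<phi> 0)"
      by (simp only: D_z mult_ac)
    have "returns (2 * \<rho>) i \<subseteq> returns (2 * \<rho>) (Suc i)" by (auto simp: returns_def)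
    then have "?h i \<le> ?h (Suc i)" by (rule card_mono[rotated]) simp
    then have "\<kappa> ^ ((d - 1) * ?h (Suc i)) \<le> \<kappa> ^ ((d - 1) * ?h i)"
      using \<kappa> by (intro power_decreasing) auto
    then have "\<kappa> ^ ((d - 1) * ?h (Suc i)) * (\<rho> / 2) \<le> \<kappa> ^ ((d - 1) * ?h i) * (\<rho> / 2)"
      using \<rho> by (intro mult_right_mono) auto
    also have "\<dots> \<le> norm (D (Suc i) z) * norm (deriv \<eta> 0)" using \<phi>(5) e by simp
    finally have bd: "\<kappa> ^ ((d - 1) * ?h (Suc i)) * (\<rho> / 2) \<le> norm (D (Suc i) z) * norm (deriv \<eta> 0)" .
    have "(f ^^ Suc i) (\<eta> u) \<in> ball y (\<rho> / 2)" if "u \<in> ball 0 1" for u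
      using land[of "\<eta> u"] \<eta>(4)[OF that] that by auto
    then show ?thesis using \<eta>(1-3) bd unfolding z_def y_def by blast
  next
    case True
    obtain \<eta> \<psi> v where \<eta>: "\<eta> holomorphic_on ball 0 1" "inj_on \<eta> (ball 0 1)" "\<eta> 0 = z"
      "\<And>u. u \<in> ball 0 1 \<Longrightarrow> \<eta> u ^ d + c \<in> \<phi> ` ball 0 1"
      "\<psi> holomorphic_on ball 0 1" "inj_on \<psi> (ball 0 1)" "\<psi> 0 = 0" "v \<in> ball 0 1" "\<psi> v = z"
      "\<And>u. u \<in> ball 0 1 \<Longrightarrow> \<psi> u ^ d + c \<in> \<phi> ` ball 0 1"
      "norm (of_nat d * z ^ (d - 1)) * norm (deriv \<eta> 0) \<ge> norm v ^ (d - 1) * norm (deriv \<phi> 0)"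
      by (rule lift_ramified[OF \<phi>(1,2) True \<phi>0 z d0]) (rule that; assumption)
    have near: "norm w < 3 / 2 * \<rho>" if "w \<in> ball y (\<rho> / 2)" for w
      using that y norm_triangle_ineq2[of w y] by (simp add: dist_norm norm_minus_commute)
    \<comment> \<open>Ramification means that 0 itself lands within \<open>\<rho> / 2\<close> of
      \<open>y\<close>, and \<open>norm y = \<rho>\<close>: so \<open>Suc i\<close> is a return
      time.\<close>
    have ret: "norm ((f ^^ Suc i) 0) < 3 / 2 * \<rho>"
      by (rule near[OF land]) (use True d0 in \<open>simp add: power_0_left\<close>)
    \<comment> \<open>Otherwise \<open>f ^^ Suc i\<close> would map the disc of radius
      \<open>2 * \<rho>\<close> into the concentric disc of radius \<open>3 / 2 * \<rho>\<close>, a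
      trapped disc met by the orbit of \<open>c\<close>.\<close>
    have "\<not> ball 0 (2 * \<rho>) \<subseteq> \<psi> ` ball 0 1"
    proof
      assume sub: "ball 0 (2 * \<rho>) \<subseteq> \<psi> ` ball 0 1"
      have "(f ^^ Suc i) ` ball 0 (2 * \<rho>) \<subseteq> ball 0 (3 / 2 * \<rho>)"
      proof
        fix w assume "w \<in> (f ^^ Suc i) ` ball 0 (2 * \<rho>)"
        then obtain u where "u \<in> ball 0 1" "w = (f ^^ Suc i) (\<psi> u)" using sub by blast
        then show "w \<in> ball 0 (3 / 2 * \<rho>)" using near[OF land[OF \<eta>(10)]] by simp
      qed
      moreover have "(f ^^ i) c \<in> ball 0 (2 * \<rho>)"
        using ret \<rho> by (simp add: funpow_Suc_right f_0 del: funpow.simps)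
      ultimately show False using no_trapping_disc[of "Suc i" "3 / 2 * \<rho>" "2 * \<rho>" i 0] \<rho> by simp
    qed
    then have v: "\<kappa> \<le> norm v" using koebe[rule_format, of \<psi> v] \<eta>(5-7,9) z_ge by simp
    have "returns (2 * \<rho>) (Suc i) = insert (Suc i) (returns (2 * \<rho>) i)"
      using ret \<rho> by (auto simp: returns_def le_Suc_eq simp del: funpow.simps)
    moreover have "Suc i \<notin> returns (2 * \<rho>) i" by (simp add: returns_def)
    ultimately have "?h (Suc i) = Suc (?h i)" by simp
    then have "\<kappa> ^ ((d - 1) * ?h (Suc i)) * (\<rho> / 2) = \<kappa> ^ (d - 1) * (\<kappa> ^ ((d - 1) * ?h i) * (\<rho> / 2))"
      by (simp add: power_add)
    also have "\<dots> \<le> norm v ^ (d - 1) * (norm (D i (f z)) * norm (deriv \<phi> 0))"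
      by (rule mult_mono[OF power_mono \<phi>(5)]) (use \<kappa> \<rho> v in auto)
    also have "\<dots> \<le> norm (D i (f z)) * (norm (of_nat d * z ^ (d - 1)) * norm (deriv \<eta> 0))"
      using mult_left_mono[OF \<eta>(11), of "norm (D i (f z))"] by (simp add: mult_ac)
    also have "\<dots> = norm (D (Suc i) z) * norm (deriv \<eta> 0)" by (simp only: D_z mult_ac)
    finally have bd: "\<kappa> ^ ((d - 1) * ?h (Suc i)) * (\<rho> / 2) \<le> norm (D (Suc i) z) * norm (deriv \<eta> 0)" .
    have "(f ^^ Suc i) (\<eta> u) \<in> ball y (\<rho> / 2)" if "u \<in> ball 0 1" for u
      using land[OF \<eta>(4)[OF that]] .
    then show ?thesis using \<eta>(1-3) bd unfolding z_def y_def by blast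
  qed
qed

text \<open>The full pullback has conformal radius of order at most \<open>\<rho> ^ d\<close>, since
  it omits a point of \<open>ball c ((2 * \<rho>) ^ d)\<close>. Compared with the lower bound from
  \<open>univalent_pullback\<close>, and after one further derivative factor, all powers of
  \<open>\<rho>\<close> cancel. What remains is a loss per return and one constant, both small
  relative to \<open>s\<close> because small \<open>\<delta>\<close> forces long return
  times.\<close>

lemma closest_approach:
  assumes "\<epsilon> > 0"
  obtains \<delta> where "\<delta> > 0"
    "\<And>\<rho> x s. \<lbrakk>0 < \<rho>; \<rho> < \<delta>; norm (x - c) \<le> \<rho> ^ d; norm ((f ^^ s) x) = \<rho>;
       \<forall>j<s. norm ((f ^^ j) x) \<ge> \<rho>\<rbrakk> \<Longrightarrow> norm (D (Suc s) x) \<ge> exp (- \<epsilon> * real (Suc s))"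
proof -
  obtain M \<kappa> :: real where M: "M > 0" and \<kappa>: "0 < \<kappa>" "\<kappa> < 1"
    and MM: "\<And>\<phi> w. \<lbrakk>\<phi> holomorphic_on ball 0 1; inj_on \<phi> (ball 0 1); w \<notin> \<phi> ` ball 0 1\<rbrakk>
        \<Longrightarrow> norm (deriv \<phi> 0) \<le> M * norm (w - \<phi> 0)"
    and \<kappa>\<kappa>: "\<And>\<psi> v \<rho>. \<lbrakk>\<psi> holomorphic_on ball 0 1; inj_on \<psi> (ball 0 1); \<psi> 0 = 0; \<rho> > 0;
        \<not> ball 0 (2 * \<rho>) \<subseteq> \<psi> ` ball 0 1; norm (\<psi> v) \<ge> \<rho>\<rbrakk> \<Longrightarrow> \<kappa> \<le> norm v"
    by (rule univalent_omitting_lower_bound) (rule that; assumption)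
  define C where "C = M * (2 ^ d + 1)"
  have C: "C > 0" using M by (simp add: C_def add_pos_pos)
  \<comment> \<open>\<open>\<alpha>\<close> is the logarithmic loss per return and
    \<open>\<mu>\<close> bounds the single loss \<open>ln C\<close>; \<open>N\<close> is chosen so
    that their sum is below \<open>\<epsilon> * N\<close>.\<close>
  define \<alpha> where "\<alpha> = - ln \<kappa> * real (d - 1)"
  define \<mu> where "\<mu> = max 0 (ln C)"
  have al: "\<alpha> \<ge> 0" "\<mu> \<ge> 0" "\<mu> \<ge> ln C"
    using \<kappa> by (auto simp: \<alpha>_def \<mu>_def mult_nonpos_nonneg)
  obtain N where N: "(\<alpha> + \<mu>) / \<epsilon> < real N" using reals_Archimedean2 by blast
  obtain \<delta> where \<delta>: "\<delta> > 0" "\<And>p z. \<lbrakk>0 < p; p \<le> N; norm z < \<delta>\<rbrakk> \<Longrightarrow> norm ((f ^^ p) z) \<ge> \<delta>"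
    by (rule return_time_large[of N]) (rule that; assumption)
  show ?thesis
  \<comment> \<open>Halved because returns are counted at radius \<open>2 * \<rho>\<close>, which
    has to stay below \<open>\<delta>\<close>.\<close>
  proof (rule that[of "\<delta> / 2"])
    show "\<delta> / 2 > 0" using \<delta> by simp
    fix \<rho> x s
    assume \<rho>: "0 < \<rho>" "\<rho> < \<delta> / 2" and x: "norm (x - c) \<le> \<rho> ^ d" and s: "norm ((f ^^ s) x) = \<rho>"
      and away: "\<forall>j<s. norm ((f ^^ j) x) \<ge> \<rho>"
    have d0: "d > 0" using d_ge_2 by simp
    \<comment> \<open>A preimage \<open>z\<close> of \<open>x\<close> satisfies
      \<open>norm z \<le> \<rho>\<close> and comes back to modulus \<open>\<rho> < \<delta>\<close>
      after \<open>Suc s\<close> steps, which is impossible within \<open>N\<close> steps.\<close>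
    have sN: "N < Suc s"
    proof (rule ccontr)
      assume *: "\<not> N < Suc s"
      obtain z where z: "x - c = z ^ d" by (rule exists_complex_root[of d "x - c"]) (use d0 in simp)
      then have "norm z ^ d \<le> \<rho> ^ d" using x by (simp add: norm_power)
      then have "norm z \<le> \<rho>" using \<rho> d0 by (simp add: power_mono_iff)
      then have "norm ((f ^^ Suc s) z) \<ge> \<delta>" using * \<rho> by (intro \<delta>(2)) auto
      moreover have "f z = x" using z by (simp add: f_def algebra_simps)
      ultimately show False using s \<rho> \<delta> by (simp add: funpow_Suc_right del: funpow.simps)
    qed
    have koebe: "\<forall>\<psi> v. \<psi> holomorphic_on ball 0 1 \<and> inj_on \<psi> (ball 0 1) \<and> \<psi> 0 = 0 \<and>
        \<not> ball 0 (2 * \<rho>) \<subseteq> \<psi> ` ball 0 1 \<and> norm (\<psi> v) \<ge> \<rho> \<longrightarrow> \<kappa> \<le> norm v"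
      using \<kappa>\<kappa>[OF _ _ _ \<rho>(1)] by blast
    obtain \<phi> where \<phi>: "\<phi> holomorphic_on ball 0 1" "inj_on \<phi> (ball 0 1)" "\<phi> 0 = x"
      "\<And>u. u \<in> ball 0 1 \<Longrightarrow> (f ^^ s) (\<phi> u) \<in> ball ((f ^^ s) x) (\<rho> / 2)"
      "\<kappa> ^ ((d - 1) * card (returns (2 * \<rho>) s)) * (\<rho> / 2) \<le> norm (D s x) * norm (deriv \<phi> 0)"
      using univalent_pullback[OF \<kappa> koebe \<rho>(1) _ s order_refl] away by auto
    have "\<not> ball c ((2 * \<rho>) ^ d) \<subseteq> \<phi> ` ball 0 1"
    proof
      assume sub: "ball c ((2 * \<rho>) ^ d) \<subseteq> \<phi> ` ball 0 1"
      have "(f ^^ Suc s) ` ball c ((2 * \<rho>) ^ d) \<subseteq> ball c ((3 / 2 * \<rho>) ^ d)"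
      proof
        fix w assume "w \<in> (f ^^ Suc s) ` ball c ((2 * \<rho>) ^ d)"
        then obtain u where u: "u \<in> ball 0 1" "w = f ((f ^^ s) (\<phi> u))" using sub by auto
        have "norm ((f ^^ s) (\<phi> u)) < 3 / 2 * \<rho>"
          using \<phi>(4)[OF u(1)] s norm_triangle_ineq2[of "(f ^^ s) (\<phi> u)" "(f ^^ s) x"]
          by (simp add: dist_norm norm_minus_commute)
        then have "norm ((f ^^ s) (\<phi> u)) ^ d < (3 / 2 * \<rho>) ^ d"
          using d0 by (intro power_strict_mono) auto
        then show "w \<in> ball c ((3 / 2 * \<rho>) ^ d)" by (simp add: u f_def dist_norm norm_power)
      qed
      moreover have "(3 / 2 * \<rho>) ^ d < (2 * \<rho>) ^ d" using \<rho> d0 by (intro power_strict_mono) auto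
      moreover have "(f ^^ 0) c \<in> ball c ((2 * \<rho>) ^ d)" using \<rho> by simp
      ultimately show False using no_trapping_disc[of "Suc s"] by blast
    qed
    then obtain w where "w \<in> ball c ((2 * \<rho>) ^ d)" "w \<notin> \<phi> ` ball 0 1" by blast
    then have w: "norm (w - c) < (2 * \<rho>) ^ d" "w \<notin> \<phi> ` ball 0 1"
      by (auto simp: dist_norm norm_minus_commute)
    have "norm (w - x) \<le> norm (w - c) + norm (x - c)"
      using norm_triangle_ineq4[of "w - c" "x - c"] by simp
    also have "\<dots> \<le> (2 ^ d + 1) * \<rho> ^ d" using w x by (simp add: power_mult_distrib algebra_simps)
    finally have "M * norm (w - \<phi> 0) \<le> M * ((2 ^ d + 1) * \<rho> ^ d)" using M \<phi>(3) by simp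
    with MM[OF \<phi>(1,2) w(2)] have \<phi>d: "norm (deriv \<phi> 0) \<le> C * \<rho> ^ d" by (simp add: C_def mult_ac)
    define h where "h = card (returns (2 * \<rho>) s)"
    have "h \<le> card (returns \<delta> s)"
      unfolding h_def using \<rho> by (intro card_mono) (auto simp: returns_def)
    then have "h * Suc N \<le> card (returns \<delta> s) * Suc N" by (rule mult_right_mono) simp
    also have "\<dots> \<le> s" by (rule card_returns[OF \<delta>(2,1)])
    finally have h: "real h * real (Suc N) \<le> real (Suc s)"
      by (metis le_Suc_eq of_nat_le_iff of_nat_mult)
    have "\<kappa> ^ ((d - 1) * h) * (\<rho> / 2) \<le> norm (D s x) * (C * \<rho> ^ d)"
      using \<phi>(5) mult_left_mono[OF \<phi>d norm_ge_zero[of "D s x"]] unfolding h_def by linarith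
    \<comment> \<open>The new factor is the modulus of the derivative of \<open>f\<close> at
      \<open>(f ^^ s) x\<close>. It turns \<open>D s x\<close> into \<open>D (Suc s) x\<close> and
      leaves \<open>\<rho> ^ d\<close> on both sides.\<close>
    then have "(\<kappa> ^ ((d - 1) * h) * (\<rho> / 2)) * (d * \<rho> ^ (d - 1)) \<le> (norm (D s x) * (C * \<rho> ^ d)) * (d * \<rho> ^ (d - 1))"
      using \<rho> by (intro mult_right_mono) auto
    also have "\<dots> = C * norm (D (Suc s) x) * \<rho> ^ d"
      using s by (simp add: D_Suc norm_mult norm_power)
    also have "(\<kappa> ^ ((d - 1) * h) * (\<rho> / 2)) * (d * \<rho> ^ (d - 1)) = \<kappa> ^ ((d - 1) * h) * (d / 2) * \<rho> ^ d"
      using d0 by (cases d) auto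
    finally have e: "\<kappa> ^ ((d - 1) * h) * (d / 2) \<le> C * norm (D (Suc s) x)" using \<rho> by simp
    have "\<kappa> ^ ((d - 1) * h) * 1 \<le> \<kappa> ^ ((d - 1) * h) * (d / 2)"
      using \<kappa> d_ge_2 by (intro mult_left_mono) auto
    with e have e1: "\<kappa> ^ ((d - 1) * h) \<le> C * norm (D (Suc s) x)" by linarith
    have "\<kappa> ^ ((d - 1) * h) = exp (ln \<kappa>) ^ ((d - 1) * h)" using \<kappa> by simp
    also have "\<dots> = exp (- \<alpha> * h)" by (simp add: exp_of_nat_mult[symmetric] \<alpha>_def mult_ac)
    finally have e2: "exp (- \<alpha> * h) \<le> C * norm (D (Suc s) x)" using e1 by simp
    \<comment> \<open>Both \<open>h\<close> and 1 are at most \<open>Suc s / Suc N\<close>; as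
      \<open>\<mu>\<close> is truncated at 0, the second estimate may be multiplied by it.\<close>
    have "(\<alpha> * h + \<mu>) * Suc N \<le> \<alpha> * Suc s + \<mu> * Suc s"
    proof -
      have "\<alpha> * (real h * real (Suc N)) \<le> \<alpha> * real (Suc s)" using h al by (intro mult_left_mono) auto
      moreover have "\<mu> * real (Suc N) \<le> \<mu> * real (Suc s)" using sN al by (intro mult_left_mono) auto
      ultimately show ?thesis by (simp add: algebra_simps)
    qed
    also have "\<dots> = (\<alpha> + \<mu>) * Suc s" by (simp add: algebra_simps)
    also have "\<dots> \<le> (\<epsilon> * Suc N) * Suc s"
      using N assms by (intro mult_right_mono) (auto simp: field_simps)
    finally have "(\<alpha> * h + \<mu>) * real (Suc N) \<le> (\<epsilon> * Suc s) * real (Suc N)" by (simp only: mult_ac)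
    then have fin: "\<alpha> * h + \<mu> \<le> \<epsilon> * Suc s" by (rule mult_right_le_imp_le) simp
    have "exp (- \<epsilon> * real (Suc s)) \<le> exp (- \<alpha> * h - ln C)" using fin al by simp
    also have "\<dots> = exp (- \<alpha> * h) / C" using C by (simp add: exp_diff)
    also have "\<dots> \<le> norm (D (Suc s) x)" using e2 C by (simp add: divide_le_eq mult.commute)
    finally show "norm (D (Suc s) x) \<ge> exp (- \<epsilon> * real (Suc s))" .
  qed
qed

subsection \<open>Orbit segments away from the critical point\<close>

text \<open>Each step costs at most a factor \<open>exp \<epsilon>\<close> beyond the derivative
  along the orbit of \<open>w\<close>. The assumed contraction
  \<open>exp (- 2 * \<epsilon> * i)\<close> outweighs the accumulated cost, so the displacement
  never leaves the range \<open>\<tau> * \<delta>\<close> in which the local estimate holds.\<close>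

lemma iterate_near:
  assumes exp: "\<And>w z :: complex. norm (z - w) \<le> \<tau> * norm w \<Longrightarrow>
      norm (z ^ d - w ^ d) \<le> exp \<epsilon> * (norm (of_nat d * w ^ (d - 1)) * norm (z - w))"
    and "\<tau> > 0" "\<epsilon> > 0" and away: "\<And>i. i < p \<Longrightarrow> norm ((f ^^ i) w) \<ge> \<delta>"
    and contr: "\<And>i. i \<le> p \<Longrightarrow> norm (D i w) \<le> exp (- 2 * \<epsilon> * real i)"
    and z: "norm (z - w) \<le> \<tau> * \<delta>" and "i \<le> p"
  shows "norm ((f ^^ i) z - (f ^^ i) w) \<le> exp (- \<epsilon> * real i) * norm (z - w)"
proof -
  have main: "norm ((f ^^ i) z - (f ^^ i) w) \<le> exp (\<epsilon> * real i) * norm (D i w) * norm (z - w)"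
    and less: "exp (\<epsilon> * real i) * norm (D i w) \<le> exp (- \<epsilon> * real i)" if "i \<le> p" for i
    using that
  proof (induction i)
    case (Suc i)
    {
      case 1
      let ?u = "(f ^^ i) z" and ?v = "(f ^^ i) w"
      have IH: "norm (?u - ?v) \<le> exp (\<epsilon> * real i) * norm (D i w) * norm (z - w)"
        "exp (\<epsilon> * real i) * norm (D i w) \<le> exp (- \<epsilon> * real i)"
        using Suc 1 by auto
      have "exp (- \<epsilon> * real i) \<le> 1" using assms(3) by simp
      with IH(2) have "exp (\<epsilon> * real i) * norm (D i w) \<le> 1" by (rule order_trans)
      then have "exp (\<epsilon> * real i) * norm (D i w) * norm (z - w) \<le> 1 * norm (z - w)"
        by (rule mult_right_mono) simp
      then have "norm (?u - ?v) \<le> \<tau> * \<delta>" using IH(1) z by linarith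
      also have "\<dots> \<le> \<tau> * norm ?v" using away[of i] 1 assms(2) by (intro mult_left_mono) auto
      finally have "norm (?u ^ d - ?v ^ d) \<le> exp \<epsilon> * (norm (of_nat d * ?v ^ (d - 1)) * norm (?u - ?v))"
        by (rule exp)
      also have "\<dots> \<le> exp \<epsilon> * (norm (of_nat d * ?v ^ (d - 1)) * (exp (\<epsilon> * real i) * norm (D i w) * norm (z - w)))"
        using IH(1) by (intro mult_left_mono) auto
      also have "\<dots> = exp \<epsilon> * exp (\<epsilon> * real i) * norm (D (Suc i) w) * norm (z - w)"
        by (simp add: D_Suc norm_mult mult_ac)
      also have "exp \<epsilon> * exp (\<epsilon> * real i) = exp (\<epsilon> * real (Suc i))"
        by (simp add: exp_add[symmetric] algebra_simps)
      also have "?u ^ d - ?v ^ d = (f ^^ Suc i) z - (f ^^ Suc i) w" by (simp add: f_def)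
      finally show ?case .
    next
      case 2
      have "exp (\<epsilon> * real (Suc i)) * norm (D (Suc i) w) \<le> exp (\<epsilon> * real (Suc i)) * exp (- 2 * \<epsilon> * real (Suc i))"
        using contr[OF 2] by (intro mult_left_mono) auto
      also have "\<dots> = exp (- \<epsilon> * real (Suc i))" by (simp add: exp_add[symmetric])
      finally show ?case .
    }
  qed auto
  have "norm ((f ^^ i) z - (f ^^ i) w) \<le> exp (\<epsilon> * real i) * norm (D i w) * norm (z - w)"
    by (rule main[OF \<open>i \<le> p\<close>])
  also have "\<dots> \<le> exp (- \<epsilon> * real i) * norm (z - w)"
    by (rule mult_right_mono[OF less[OF \<open>i \<le> p\<close>]]) simp
  finally show ?thesis .
qed

lemma away_from_critical_point:
  assumes "\<epsilon> > 0" "\<delta> > 0" and bdd: "\<And>n. norm ((f ^^ n) c) \<le> R"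
  obtains C where "C > 0"
    "\<And>a n. \<forall>j<n. norm ((f ^^ (a + j)) c) \<ge> \<delta> \<Longrightarrow>
       norm (D n ((f ^^ a) c)) \<ge> C * exp (- \<epsilon> * real n)"
proof -
  \<comment> \<open>The suffix maxima yield contraction at rate \<open>e\<close>; half of this is
    spent on nonlinearity in \<open>iterate_near\<close>, and the rate \<open>e / 2\<close>
    remains.\<close>
  define e where "e = \<epsilon> / 2"
  have e: "e > 0" "e / 2 > 0" using assms by (auto simp: e_def)
  have d0: "d > 0" using d_ge_2 by simp
  obtain \<tau> where \<tau>: "\<tau> > 0"
    "\<And>w z :: complex. norm (z - w) \<le> \<tau> * norm w \<Longrightarrow>
      norm (z ^ d - w ^ d) \<le> exp (e / 2) * (norm (of_nat d * w ^ (d - 1)) * norm (z - w))"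
    by (rule power_local_expansion[OF e(2) d0]) (rule that; assumption)
  define \<eta> where "\<eta> = \<tau> * \<delta>"
  have \<eta>: "\<eta> > 0" using \<tau> assms by (simp add: \<eta>_def)
  obtain K where K: "finite K" "cball (0::complex) R \<subseteq> (\<Union>x\<in>K. ball x (\<eta> / 8))"
    using compact_cball[of "0::complex" R] \<eta> unfolding compact_eq_totally_bounded by (metis divide_pos_pos zero_less_numeral)
  define P where "P = card K"
  \<comment> \<open>Chosen so that \<open>exp (- (e / 2) * p) \<le> 1 / 4\<close> for every time gap
    \<open>p \<ge> L\<close>.\<close>
  obtain L0 :: nat where L0: "4 * ln 4 / \<epsilon> < real L0" using reals_Archimedean2 by blast
  define L where "L = Suc L0"
  \<comment> \<open>Bounds the decrease of \<open>T\<close> in one step, since each derivative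
    factor is at least \<open>d * \<delta> ^ (d - 1)\<close> in modulus.\<close>
  define A where "A = max 1 (- ln (real d * \<delta> ^ (d - 1)))"
  have A: "A > 0" by (simp add: A_def)
  define C where "C = exp (- (real P * real L * A))"
  show ?thesis
  proof (rule that[of C])
    show "C > 0" by (simp add: C_def)
    fix a n
    assume away: "\<forall>j<n. norm ((f ^^ (a + j)) c) \<ge> \<delta>"
    define x where "x = (f ^^ a) c"
    have fx: "(f ^^ j) x = (f ^^ (a + j)) c" for j by (simp add: x_def funpow_add_apply add.commute)
    have away': "norm ((f ^^ j) x) \<ge> \<delta>" if "j < n" for j using away that by (simp add: fx)
    have Dnz: "D k x \<noteq> 0" if "k \<le> n" for k
    proof -
      have "(f ^^ j) x \<noteq> 0" if "j < k" for j using away'[of j] that \<open>k \<le> n\<close> assms(2) by auto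
      then show ?thesis using d0 by (auto simp: D_def)
    qed
    define T where "T k = ln (norm (D k x)) + e * real k" for k
    have step: "T (Suc k) \<ge> T k - A" if k: "k < n" for k
    proof -
      have pos: "real d * \<delta> ^ (d - 1) > 0" using d0 assms by simp
      have "norm (of_nat d * (f ^^ k) x ^ (d - 1)) = real d * norm ((f ^^ k) x) ^ (d - 1)"
        by (simp add: norm_mult norm_power)
      moreover have "\<dots> \<ge> real d * \<delta> ^ (d - 1)"
        using away'[OF k] assms by (intro mult_left_mono power_mono) auto
      ultimately have "ln (norm (of_nat d * (f ^^ k) x ^ (d - 1))) \<ge> ln (real d * \<delta> ^ (d - 1))"
        using pos by (subst ln_le_cancel_iff) auto
      moreover have "- A \<le> ln (real d * \<delta> ^ (d - 1))" by (simp add: A_def)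
      moreover have "ln (norm (D (Suc k) x)) = ln (norm (D k x)) + ln (norm (of_nat d * (f ^^ k) x ^ (d - 1)))"
      proof -
        have "D (Suc k) x \<noteq> 0" "D k x \<noteq> 0" using Dnz k by auto
        then show ?thesis unfolding D_Suc norm_mult[of "D k x"] by (intro ln_mult_pos) auto
      qed
      ultimately show ?thesis using e by (simp add: T_def algebra_simps)
    qed
    have "T n \<ge> - (real P * real L * A)"
    proof (rule ccontr)
      assume "\<not> T n \<ge> - (real P * real L * A)"
      then have Tn: "T n < - (real P * real L * A)" by simp
      have T0: "T 0 = 0" by (simp add: T_def)
      obtain m where m: "\<And>i. i \<le> P \<Longrightarrow> m i \<le> n"
        "\<And>i k. i \<le> P \<Longrightarrow> m i \<le> k \<Longrightarrow> k \<le> n \<Longrightarrow> T k \<le> T (m i)"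
        "\<And>i j. i < j \<Longrightarrow> j \<le> P \<Longrightarrow> m i + L \<le> m j"
        by (rule suffix_maxima[OF T0 step A Tn]) (assumption, simp add: L_def, (rule that; assumption))
      \<comment> \<open>No later \<open>T\<close> exceeds \<open>T (m i)\<close>, so the derivatives
        from time \<open>m i\<close> on contract. Over the gap, the disc of radius
        \<open>\<eta>\<close> about \<open>w\<close> shrinks to radius \<open>\<eta> / 4\<close>
        about a point within \<open>\<eta> / 4\<close> of \<open>w\<close>: a trapped disc.\<close>
      have sep: False if ij: "i < j" "j \<le> P" and close: "norm ((f ^^ m j) x - (f ^^ m i) x) \<le> \<eta> / 4" for i j
      proof -
        define p where "p = m j - m i"
        define w where "w = (f ^^ m i) x"
        have mij: "m i + L \<le> m j" "m j \<le> n" using m ij by auto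
        have pL: "L \<le> p" and mp: "m i + p = m j" using mij by (auto simp: p_def)
        have fw: "(f ^^ k) w = (f ^^ (m i + k)) x" for k by (simp add: w_def funpow_add_apply add.commute)
        have contr: "norm (D k w) \<le> exp (- 2 * (e / 2) * real k)" if k: "k \<le> p" for k
        proof -
          have k': "m i + k \<le> n" using k mp mij by linarith
          have "D (m i + k) x = D (m i) x * D k w" by (simp add: D_add w_def)
          moreover have nz: "D (m i + k) x \<noteq> 0" "D (m i) x \<noteq> 0" using Dnz k' by auto
          ultimately have nz': "D k w \<noteq> 0" and
            "ln (norm (D (m i + k) x)) = ln (norm (D (m i) x)) + ln (norm (D k w))"
            using ln_mult_pos[of "norm (D (m i) x)" "norm (D k w)"] by (auto simp: norm_mult)
          then have "ln (norm (D k w)) \<le> - e * real k"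
            using m(2)[of i "m i + k"] k' ij by (simp add: T_def algebra_simps)
          then have "exp (ln (norm (D k w))) \<le> exp (- e * real k)" by simp
          then show ?thesis using nz' by simp
        qed
        have "(f ^^ p) ` ball w \<eta> \<subseteq> ball w (3 / 4 * \<eta>)"
        proof
          fix y assume "y \<in> (f ^^ p) ` ball w \<eta>"
          then obtain z where "z \<in> ball w \<eta>" "y = (f ^^ p) z" by blast
          then have z: "norm (z - w) < \<eta>" "y = (f ^^ p) z"
            by (auto simp: dist_norm norm_minus_commute)
          have "norm ((f ^^ p) z - (f ^^ p) w) \<le> exp (- (e / 2) * real p) * norm (z - w)"
          proof (rule iterate_near[OF \<tau>(2,1) e(2) _ contr])
            show "norm ((f ^^ k) w) \<ge> \<delta>" if "k < p" for k
              unfolding fw by (rule away') (use that mp mij in linarith)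
          qed (use z \<eta>_def in auto)
          also have "\<dots> \<le> 1 / 4 * \<eta>"
          proof (rule mult_mono)
            have "ln 4 \<le> (e / 2) * real p"
            proof -
              have "4 * ln 4 / \<epsilon> \<le> real p" using L0 pL unfolding L_def by linarith
              then show ?thesis using assms(1) by (simp add: e_def field_simps)
            qed
            then have "exp (- (e / 2) * real p) \<le> exp (- ln 4)" by simp
            then show "exp (- (e / 2) * real p) \<le> 1 / 4" by (simp add: exp_minus)
          qed (use z in auto)
          finally have "norm ((f ^^ p) z - (f ^^ p) w) \<le> 1 / 4 * \<eta>" .
          moreover have "norm ((f ^^ p) w - w) \<le> \<eta> / 4" using close unfolding fw mp by (simp add: w_def)
          ultimately have "norm (y - w) \<le> \<eta> / 2"
            using norm_triangle_ineq[of "(f ^^ p) z - (f ^^ p) w" "(f ^^ p) w - w"] z by simp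
          then show "y \<in> ball w (3 / 4 * \<eta>)" using \<eta> by (simp add: dist_norm norm_minus_commute)
        qed
        moreover have "(f ^^ (a + m i)) c \<in> ball w \<eta>" using \<eta> fx by (simp add: w_def)
        moreover have "p > 0" using pL by (simp add: L_def)
        ultimately show False using no_trapping_disc[of p "3 / 4 * \<eta>" \<eta> "a + m i" w] \<eta> by simp
      qed
      have "\<exists>k\<in>K. (f ^^ m i) x \<in> ball k (\<eta> / 8)" for i
        using K(2) bdd[of "a + m i"] by (force simp: fx)
      then obtain g where g: "\<And>i. g i \<in> K" "\<And>i. (f ^^ m i) x \<in> ball (g i) (\<eta> / 8)" by metis
      have "g ` {..P} \<subseteq> K" using g(1) by blast
      \<comment> \<open>There are \<open>P + 1\<close> times but only \<open>P\<close> centres, and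
        balls of radius \<open>\<eta> / 8\<close> give two points within
        \<open>\<eta> / 4\<close>.\<close>
      then have "card (g ` {..P}) < card {..P}" using card_mono[OF K(1)] by (simp add: P_def less_Suc_eq_le)
      then have "\<not> inj_on g {..P}" by (rule pigeonhole)
      then have "\<exists>i j. i < j \<and> j \<le> P \<and> g i = g j"
        unfolding inj_on_def by (metis atMost_iff linorder_neqE_nat)
      then obtain i j where ij: "i < j" "j \<le> P" "g i = g j" by blast
      have "dist ((f ^^ m j) x) ((f ^^ m i) x) \<le> \<eta> / 8 + \<eta> / 8"
        using g(2)[of i] g(2)[of j] ij(3) dist_triangle3[of "(f ^^ m j) x" "(f ^^ m i) x" "g i"] by simp
      then show False using sep[OF ij(1,2)] by (simp add: dist_norm)
    qed
    then have "exp (- (real P * real L * A) - e * real n) \<le> exp (ln (norm (D n x)))"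
      by (simp add: T_def)
    also have "\<dots> = norm (D n x)" using Dnz[of n] by simp
    finally have "C * exp (- e * real n) \<le> norm (D n x)" by (simp add: C_def exp_diff exp_minus divide_inverse)
    moreover have "C * exp (- \<epsilon> * real n) \<le> C * exp (- e * real n)"
      using assms(1) by (intro mult_left_mono) (auto simp: C_def e_def mult_right_mono)
    ultimately show "norm (D n ((f ^^ a) c)) \<ge> C * exp (- \<epsilon> * real n)" by (simp add: x_def)
  qed
qed

section \<open>Decomposition of a bounded critical orbit into blocks\<close>

lemma iterate_deriv_bound_bounded:
  assumes "\<epsilon> > 0" and bdd: "\<And>n. norm ((f ^^ n) c) \<le> R"
  obtains C where "C > 0" "\<And>n. norm (D n c) \<ge> C * exp (- \<epsilon> * real n)"
proof -
  obtain \<delta> where \<delta>: "\<delta> > 0"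
    "\<And>\<rho> x s. \<lbrakk>0 < \<rho>; \<rho> < \<delta>; norm (x - c) \<le> \<rho> ^ d; norm ((f ^^ s) x) = \<rho>;
       \<forall>j<s. norm ((f ^^ j) x) \<ge> \<rho>\<rbrakk> \<Longrightarrow> norm (D (Suc s) x) \<ge> exp (- \<epsilon> * real (Suc s))"
    by (rule closest_approach[OF assms(1)]) (rule that; assumption)
  obtain C where C: "C > 0"
    "\<And>a n. \<forall>j<n. norm ((f ^^ (a + j)) c) \<ge> \<delta> \<Longrightarrow>
       norm (D n ((f ^^ a) c)) \<ge> C * exp (- \<epsilon> * real n)"
    by (rule away_from_critical_point[OF assms(1) \<delta>(1) bdd]) (rule that; assumption)
  \<comment> \<open>\<open>r\<close> stands for the preceding closest approach: the segment starts
    within \<open>r ^ d\<close> of \<open>c\<close> and never comes closer to 0 than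
    \<open>r\<close>. Blocks ending at a closest approach carry the constant 1, so \<open>C\<close>
    is paid only once, on the final segment.\<close>
  have main: "norm (D n ((f ^^ a) c)) \<ge> C * exp (- \<epsilon> * real n)"
    if "r \<ge> 0" "norm ((f ^^ a) c - c) \<le> r ^ d" "\<And>j. j < n \<Longrightarrow> norm ((f ^^ (a + j)) c) \<ge> r" for a n r
    using that
  proof (induction n arbitrary: a r rule: less_induct)
    case (less n)
    show ?case
    proof (cases "\<forall>j<n. norm ((f ^^ (a + j)) c) \<ge> \<delta>")
      case True
      then show ?thesis by (rule C(2))
    next
      case False
      define N where "N j = norm ((f ^^ (a + j)) c)" for j
      obtain j0 where j0: "j0 < n" "N j0 < \<delta>" using False by (auto simp: N_def not_le)
      define s where "s = arg_min_on N {..<n}"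
      have s: "s < n" "\<And>j. j < n \<Longrightarrow> N s \<le> N j"
        using arg_min_if_finite(1)[of "{..<n}" N] arg_min_least[of "{..<n}" _ N] j0
        by (auto simp: s_def)
      have Ns: "N s < \<delta>" "N s > 0"
      proof -
        show "N s < \<delta>" using s(2)[OF j0(1)] j0(2) by simp
        have "(f ^^ Suc (a + s)) 0 \<noteq> 0" by (rule critical_point_not_periodic) simp
        then show "N s > 0" by (simp add: N_def funpow_Suc_right f_0 del: funpow.simps)
      qed
      have fN: "norm ((f ^^ j) ((f ^^ a) c)) = N j" for j
        by (simp add: N_def funpow_add_apply add.commute)
      have "r \<le> N s" using less.prems(3)[OF s(1)] by (simp add: N_def)
      then have "r ^ d \<le> N s ^ d" using less.prems(1) by (rule power_mono)
      then have block: "norm (D (Suc s) ((f ^^ a) c)) \<ge> exp (- \<epsilon> * real (Suc s))"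
        using less.prems(2) s Ns by (intro \<delta>(2)[of "N s"]) (auto simp: fN)
      define n' where "n' = n - Suc s"
      have n: "n = Suc s + n'" using s by (simp add: n'_def)
      have "norm (D n' ((f ^^ (a + Suc s)) c)) \<ge> C * exp (- \<epsilon> * real n')"
      proof (rule less.IH[of n' "N s"])
        \<comment> \<open>The next segment starts at the image of the closest point, at distance
          exactly \<open>N s ^ d\<close> from \<open>c\<close>.\<close>
        show "norm ((f ^^ (a + Suc s)) c - c) \<le> N s ^ d"
          by (simp add: N_def f_def norm_power)
        show "N s \<le> norm ((f ^^ (a + Suc s + j)) c)" if "j < n'" for j
          using s(2)[of "Suc s + j"] that n by (simp add: N_def add.assoc del: funpow.simps)
      qed (use n Ns in auto)
      then have "exp (- \<epsilon> * real (Suc s)) * (C * exp (- \<epsilon> * real n'))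
          \<le> norm (D (Suc s) ((f ^^ a) c)) * norm (D n' ((f ^^ (a + Suc s)) c))"
        using block C(1) by (intro mult_mono) auto
      also have "\<dots> = norm (D n ((f ^^ a) c))"
        unfolding n D_add norm_mult funpow_add_apply by (simp add: add.commute)
      also have "exp (- \<epsilon> * real (Suc s)) * (C * exp (- \<epsilon> * real n')) = C * exp (- \<epsilon> * real n)"
        by (simp add: n exp_add[symmetric] algebra_simps)
      finally show ?thesis .
    qed
  qed
  show ?thesis
  proof (rule that[OF C(1)])
    show "norm (D n c) \<ge> C * exp (- \<epsilon> * real n)" for n
      \<comment> \<open>With \<open>r = 0\<close> the start is \<open>c\<close> itself and the
        condition on the approach to 0 is trivial.\<close>
      using main[of 0 0 n] by simp
  qed
qed

section \<open>Unbounded orbits and passage to the lower limit\<close>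

lemma D_c_nonzero: "D n c \<noteq> 0"
proof -
  have "(f ^^ i) c \<noteq> 0" for i
    using critical_point_not_periodic[of "Suc i"] by (simp add: funpow_Suc_right f_0 del: funpow.simps)
  then show ?thesis using d_ge_2 by (simp add: D_def)
qed

text \<open>Beyond radius \<open>2 + norm c\<close> the modulus does not decrease under
  \<open>f\<close>, so every further derivative factor is at least 1. The finitely many earlier
  derivatives are nonzero and have a positive minimum.\<close>

lemma iterate_deriv_bound_unbounded:
  assumes n0: "norm ((f ^^ n0) c) > 2 + norm c"
  obtains C where "C > 0" "\<And>n. norm (D n c) \<ge> C"
proof -
  have grow: "norm (f z) \<ge> norm z" if z: "norm z \<ge> 2 + norm c" for z
  proof -
    have z1: "norm z \<ge> 1" using z norm_ge_zero[of c] by linarith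
    have "norm z ^ 2 \<le> norm z ^ d" using z1 d_ge_2 by (intro power_increasing)
    moreover have "norm z ^ 2 \<ge> 2 * norm z" using mult_right_mono[of 2 "norm z" "norm z"] z norm_ge_zero[of c] by (simp add: power2_eq_square)
    moreover have "norm (f z) \<ge> norm z ^ d - norm c"
      using norm_diff_ineq[of "z ^ d" c] by (simp add: f_def norm_power)
    ultimately show ?thesis using z by linarith
  qed
  have big: "norm ((f ^^ (n0 + k)) c) \<ge> 2 + norm c" for k
  proof (induction k)
    case (Suc k)
    then show ?case using grow[OF Suc] by simp
  qed (use n0 in simp)
  have inc: "norm (D (n0 + k) c) \<ge> norm (D n0 c)" for k
  proof (induction k)
    case (Suc k)
    let ?z = "(f ^^ (n0 + k)) c"
    have "norm ?z \<ge> 1" using big[of k] norm_ge_zero[of c] by linarith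
    then have "1 * 1 \<le> real d * norm ?z ^ (d - 1)" using d_ge_2 by (intro mult_mono one_le_power) auto
    then have "norm (D (n0 + k) c) * 1 \<le> norm (D (n0 + k) c) * (real d * norm ?z ^ (d - 1))"
      by (intro mult_left_mono) auto
    then show ?case using Suc by (simp add: D_Suc norm_mult norm_power)
  qed simp
  define C where "C = Min ((\<lambda>n. norm (D n c)) ` {..n0})"
  have C: "C > 0" unfolding C_def using D_c_nonzero by (subst Min_gr_iff) auto
  have Cle: "C \<le> norm (D n c)" if "n \<le> n0" for n unfolding C_def using that by (intro Min_le) auto
  show ?thesis
  proof (rule that[OF C])
    show "norm (D n c) \<ge> C" for n
    proof (cases "n \<le> n0")
      case False
      then have "norm (D n c) \<ge> norm (D n0 c)" using inc[of "n - n0"] by simp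
      then show ?thesis using Cle[of n0] by simp
    qed (rule Cle)
  qed
qed

lemma iterate_deriv_bound:
  assumes "\<epsilon> > 0"
  obtains C where "C > 0" "\<And>n. norm (D n c) \<ge> C * exp (- \<epsilon> * real n)"
proof (cases "\<exists>n0. norm ((f ^^ n0) c) > 2 + norm c")
  case False
  then have "norm ((f ^^ n) c) \<le> 2 + norm c" for n by (meson not_le)
  then show ?thesis using iterate_deriv_bound_bounded[OF assms] that by blast
next
  case True
  then obtain C where C: "C > 0" "\<And>n. norm (D n c) \<ge> C" using iterate_deriv_bound_unbounded by blast
  show ?thesis
  proof (rule that[OF C(1)])
    fix n
    have "C * exp (- \<epsilon> * real n) \<le> C * 1" using C(1) assms by (intro mult_left_mono) auto
    then show "norm (D n c) \<ge> C * exp (- \<epsilon> * real n)" using C(2)[of n] by simp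
  qed
qed

text \<open>One \<open>\<epsilon>\<close> is the exponential rate of the derivative bound; the other
  absorbs \<open>ln C / n\<close>, which tends to 0.\<close>

lemma chi_minus_ge:
  assumes "\<epsilon> > 0"
  shows "chi_minus f c \<ge> ereal (- 2 * \<epsilon>)"
proof -
  obtain C where C: "C > 0" "\<And>n. norm (D n c) \<ge> C * exp (- \<epsilon> * real n)"
    by (rule iterate_deriv_bound[OF assms]) (rule that; assumption)
  have "(\<lambda>n. ln C / real n) \<longlonglongrightarrow> 0" by (rule lim_const_over_n)
  then have "\<forall>\<^sub>F n in sequentially. ln C / real n > - \<epsilon>"
    by (rule order_tendstoD(1)) (use assms in simp)
  then have "\<forall>\<^sub>F n in sequentially. ereal (- 2 * \<epsilon>) \<le> lyap_term f c n"
    using eventually_gt_at_top[of 0]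
  proof eventually_elim
    case (elim n)
    have "C * exp (- \<epsilon> * real n) > 0" using C(1) by simp
    then have "ln (C * exp (- \<epsilon> * real n)) \<le> ln (norm (D n c))"
      using C(2)[of n] by (subst ln_le_cancel_iff) auto
    moreover have "ln (C * exp (- \<epsilon> * real n)) = ln C + - \<epsilon> * real n"
      using C(1) by (subst ln_mult_pos) auto
    ultimately have "(ln C + - \<epsilon> * real n) / real n \<le> ln (norm (D n c)) / real n"
      by (intro divide_right_mono) auto
    moreover have "(ln C + - \<epsilon> * real n) / real n = ln C / real n - \<epsilon>"
      using elim(2) by (simp add: field_simps)
    ultimately show ?case using elim(1) D_c_nonzero by (simp add: lyap_term_def deriv_iterate)
  qed
  then show ?thesis unfolding chi_minus_def by (rule Liminf_bounded)
qed

lemma chi_minus_nonneg: "chi_minus f c \<ge> 0"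
proof (rule ccontr)
  assume "\<not> chi_minus f c \<ge> 0"
  then have "chi_minus f c < ereal 0" by (simp add: zero_ereal_def)
  then obtain r where r: "chi_minus f c < ereal r" "ereal r < ereal 0" using ereal_dense2 by blast
  \<comment> \<open>For \<open>\<epsilon> = - r / 2\<close> the lower bound is \<open>r\<close>
    itself, which was chosen above \<open>chi_minus f c\<close>.\<close>
  then have "ereal (- 2 * (- r / 2)) \<le> chi_minus f c" by (intro chi_minus_ge) simp
  then show False using r(1) by simp
qed

end

theorem theorem1p1:
  fixes d :: nat and c :: complex
  assumes "d \<ge> 2"
    and "\<not> in_attracting_basin (\<lambda>z. z ^ d + c) c"
  shows "chi_minus (\<lambda>z. z ^ d + c) c \<ge> 0"
proof -
  interpret unicritical d c using assms by unfold_locales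
  show ?thesis using chi_minus_nonneg by (simp add: f_def[abs_def])
qed

end
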